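(* Let $S$ be the surface in $\mathbb{C}^{3}=\operatorname{Spec}(\mathbb{C}[x,y,z])$ defined by the equation $$x\left(xz^{2}-2y^{2}z+5z-y\right)+y^{4}-5y^{2}+4=0 .$$ Then $S$ is not isomorphic (as an abstract algebraic surface) to any surface of type $S_{Q,n}$. Nevertheless, $S$ is invariant under the action of the additive group $\mathbb{C}_{+}$ on $\mathbb{C}^{3}$ defined by the locally nilpotent derivation $$\partial=x\left(2xz-2y^{2}+5\right)\frac{\partial}{\partial y}+\left(x+2y\left(2xz-2y^{2}+5\right)\right)\frac{\partial}{\partial z}$$ of $\mathbb{C}[x,y,z]$. Moreover, the algebraic quotient fibration $q:S\rightarrow S/\!/\mathbb{C}_{+}$ associated with the induced $\mathbb{C}_{+}$-action on $S$ coincides with the projection $\mathrm{pr}_{x}|_{S}:S\rightarrow\mathbb{C}$, $(x,y,z)\mapsto x$, and it restricts to a trivial $\mathbb{A}^{1}$-bundle over $\mathbb{C}^{*}$.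
   Context: For a polynomial $Q\in\mathbb{C}[x,y]$ and an integer $n\geq 1$, $S_{Q,n}\subset\mathbb{C}^{3}$ denotes the surface defined by the equation $x^{n}z-Q(x,y)=0$; a surface "of type $S_{Q,n}$" is one of these for some $Q$ and some $n$. A $\mathbb{C}$-derivation $\partial$ of a $\mathbb{C}$-algebra $A$ is locally nilpotent if every element of $A$ is annihilated by some power of $\partial$ (depending on the element). For an affine variety $V$, algebraic $\mathbb{C}_{+}$-actions on $V$ correspond to locally nilpotent derivations of $\mathcal{O}(V)$, via $f\mapsto\exp(t\partial)(f)$, $t\in\mathbb{C}$. The algebraic quotient $V/\!/\mathbb{C}_{+}$ is $\operatorname{Spec}(\mathcal{O}(V)^{\mathbb{C}_{+}})=\operatorname{Spec}(\operatorname{Ker}\partial)$, and the algebraic quotient morphism $V\to V/\!/\mathbb{C}_{+}$ is induced by the inclusion $\mathcal{O}(V)^{\mathbb{C}_{+}}\subset\mathcal{O}(V)$. A morphism $\pi:S\to\mathbb{C}$ restricts to a trivial $\mathbb{A}^{1}$-bundle over $\mathbb{C}^{*}$ if $\pi^{-1}(\mathbb{C}^{*})$ is isomorphic over $\mathbb{C}^{*}$ to $\mathbb{C}^{*}\times\mathbb{C}$. *)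

theory Defs
  imports Complex_Main "HOL-Library.FuncSet" "HOL-Computational_Algebra.Polynomial"
begin

section \<open>Polynomial rings\<close>

text \<open>
  The ring \<open>\<complex>[x,y]\<close> is \<open>complex poly poly = \<complex>[x][y]\<close> and the ring \<open>\<complex>[x,y,z]\<close> is
  \<open>complex poly poly poly = \<complex>[x][y][z]\<close>; the last variable is the outermost one.
  Points of \<open>\<complex>\<^sup>3\<close> are triples \<open>(x, y, z)\<close>.
\<close>

type_synonym poly2 = "complex poly poly"
type_synonym poly3 = "complex poly poly poly"
type_synonym point3 = "complex \<times> complex \<times> complex"

definition eval2 :: "poly2 \<Rightarrow> complex \<times> complex \<Rightarrow> complex" where
  "eval2 Q = (\<lambda>(x, y). poly (poly Q [:y:]) x)"

definition eval3 :: "poly3 \<Rightarrow> point3 \<Rightarrow> complex" where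
  "eval3 F = (\<lambda>(x, y, z). poly (poly (poly F [:[:z:]:]) [:y:]) x)"

definition const3 :: "complex \<Rightarrow> poly3" where
  "const3 c = [:[:[:c:]:]:]"

definition X :: poly3 where "X = [:[:[:0, 1:]:]:]"
definition Y :: poly3 where "Y = [:[:0, 1:]:]"
definition Z :: poly3 where "Z = [:0, 1:]"

definition d_dy :: "poly3 \<Rightarrow> poly3" where "d_dy = map_poly pderiv"
definition d_dz :: "poly3 \<Rightarrow> poly3" where "d_dz = pderiv"

lemma eval3_simps [simp]:
  "eval3 (F + G) p = eval3 F p + eval3 G p"
  "eval3 (F - G) p = eval3 F p - eval3 G p"
  "eval3 (F * G) p = eval3 F p * eval3 G p"
  "eval3 (F ^ k) p = eval3 F p ^ k"
  "eval3 1 p = 1"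
  "eval3 (numeral m) p = numeral m"
  "eval3 (const3 c) p = c"
  "eval3 X p = fst p"
  "eval3 Y p = fst (snd p)"
  "eval3 Z p = snd (snd p)"
  "eval3 [:Q:] p = eval2 Q (fst p, fst (snd p))"
  by (simp_all add: eval3_def eval2_def const3_def X_def Y_def Z_def split_beta)

lemma partial_derivatives_of_variables:
  "d_dy X = 0" "d_dy Y = 1" "d_dy Z = 0"
  "d_dz X = 0" "d_dz Y = 0" "d_dz Z = 1"
  by (simp_all add: d_dy_def d_dz_def X_def Y_def Z_def pderiv_pCons map_poly_pCons one_pCons)


section \<open>Affine varieties\<close>

text \<open>
  An affine complex variety is given by its (closed) points together with its ring of regular
  functions.  Regular functions are extensional: they are \<open>undefined\<close> outside the point set.
\<close>

record 'a variety =
  points :: "'a set"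
  regular :: "('a \<Rightarrow> complex) set"

definition affine_line :: "complex variety" where
  "affine_line = \<lparr>points = UNIV, regular = range poly\<rparr>"

definition affine_plane :: "(complex \<times> complex) variety" where
  "affine_plane = \<lparr>points = UNIV, regular = range eval2\<rparr>"

definition surface :: "poly3 \<Rightarrow> point3 variety" where
  "surface F =
     (let S = {p. eval3 F p = 0}
      in \<lparr>points = S, regular = {restrict (eval3 f) S | f. True}\<rparr>)"

text \<open>
  The open subset of \<open>V\<close> where the regular function \<open>g\<close> does not vanish; its coordinate ring is
  the localization of that of \<open>V\<close> at \<open>g\<close>.
\<close>

definition principal_open :: "'a variety \<Rightarrow> ('a \<Rightarrow> complex) \<Rightarrow> 'a variety" where
  "principal_open V g =
     (let U = {p \<in> points V. g p \<noteq> 0}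
      in \<lparr>points = U,
          regular = {restrict (\<lambda>p. f p / g p ^ k) U | f k. f \<in> regular V}\<rparr>)"

text \<open>
  For affine varieties, a map is a morphism iff it pulls regular functions back to regular
  functions.
\<close>

definition morphism :: "'a variety \<Rightarrow> 'b variety \<Rightarrow> ('a \<Rightarrow> 'b) \<Rightarrow> bool" where
  "morphism V W \<phi> \<longleftrightarrow>
     \<phi> \<in> points V \<rightarrow> points W \<and>
     (\<forall>g \<in> regular W. restrict (g \<circ> \<phi>) (points V) \<in> regular V)"

definition isomorphism :: "'a variety \<Rightarrow> 'b variety \<Rightarrow> ('a \<Rightarrow> 'b) \<Rightarrow> bool" where
  "isomorphism V W \<phi> \<longleftrightarrow>
     morphism V W \<phi> \<and>
     (\<exists>\<psi>. morphism W V \<psi> \<and>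
          (\<forall>p \<in> points V. \<psi> (\<phi> p) = p) \<and> (\<forall>q \<in> points W. \<phi> (\<psi> q) = q))"

definition isomorphic :: "'a variety \<Rightarrow> 'b variety \<Rightarrow> bool" where
  "isomorphic V W \<longleftrightarrow> (\<exists>\<phi>. isomorphism V W \<phi>)"

definition trivial_A1_bundle_over_Cstar :: "'a variety \<Rightarrow> ('a \<Rightarrow> complex) \<Rightarrow> bool" where
  "trivial_A1_bundle_over_Cstar V \<pi> \<longleftrightarrow>
     morphism V affine_line \<pi> \<and>
     (\<exists>\<phi>. isomorphism (principal_open V \<pi>) (principal_open affine_plane fst) \<phi> \<and>
          (\<forall>p \<in> points (principal_open V \<pi>). fst (\<phi> p) = \<pi> p))"


section \<open>Locally nilpotent derivations and additive group actions\<close>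

definition derivation :: "(poly3 \<Rightarrow> poly3) \<Rightarrow> bool" where
  "derivation D \<longleftrightarrow>
     (\<forall>f g. D (f + g) = D f + D g) \<and>
     (\<forall>f g. D (f * g) = f * D g + g * D f) \<and>
     (\<forall>c. D (const3 c) = 0)"

definition locally_nilpotent_derivation :: "(poly3 \<Rightarrow> poly3) \<Rightarrow> bool" where
  "locally_nilpotent_derivation D \<longleftrightarrow> derivation D \<and> (\<forall>f. \<exists>m. (D ^^ m) f = 0)"

text \<open>The index set of the sum is finite when \<open>D\<close> is locally nilpotent.\<close>

definition exp_derivation :: "(poly3 \<Rightarrow> poly3) \<Rightarrow> complex \<Rightarrow> poly3 \<Rightarrow> poly3" where
  "exp_derivation D t f =
     (\<Sum>k | (D ^^ k) f \<noteq> 0. const3 (t ^ k / fact k) * (D ^^ k) f)"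

text \<open>The automorphism of \<open>\<complex>\<^sup>3\<close> whose comorphism is \<open>exp_derivation D t\<close>.\<close>

definition C_plus_action :: "(poly3 \<Rightarrow> poly3) \<Rightarrow> complex \<Rightarrow> point3 \<Rightarrow> point3" where
  "C_plus_action D t p =
     (eval3 (exp_derivation D t X) p,
      eval3 (exp_derivation D t Y) p,
      eval3 (exp_derivation D t Z) p)"

definition additive_group_action :: "(complex \<Rightarrow> 'a \<Rightarrow> 'a) \<Rightarrow> bool" where
  "additive_group_action \<alpha> \<longleftrightarrow>
     (\<forall>p. \<alpha> 0 p = p) \<and> (\<forall>s t p. \<alpha> (s + t) p = \<alpha> s (\<alpha> t p))"


section \<open>Algebraic quotients\<close>

definition invariants :: "'a variety \<Rightarrow> (complex \<Rightarrow> 'a \<Rightarrow> 'a) \<Rightarrow> ('a \<Rightarrow> complex) set" where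
  "invariants V \<alpha> = {f \<in> regular V. \<forall>t. \<forall>p \<in> points V. f (\<alpha> t p) = f p}"

text \<open>
  The spectrum of a \<open>\<complex>\<close>-algebra \<open>B\<close> of functions on a set \<open>A\<close>: its points are the maximal ideals
  of \<open>B\<close>, given as \<open>\<complex>\<close>-algebra homomorphisms \<open>B \<rightarrow> \<complex>\<close>, and its regular functions are the elements
  of \<open>B\<close>.
\<close>

definition algebra_homs :: "'a set \<Rightarrow> ('a \<Rightarrow> complex) set \<Rightarrow> (('a \<Rightarrow> complex) \<Rightarrow> complex) set" where
  "algebra_homs A B =
     {\<chi> \<in> extensional B.
        (\<forall>c. \<chi> (\<lambda>p \<in> A. c) = c) \<and>
        (\<forall>f \<in> B. \<forall>g \<in> B. \<chi> (\<lambda>p \<in> A. f p + g p) = \<chi> f + \<chi> g) \<and>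
        (\<forall>f \<in> B. \<forall>g \<in> B. \<chi> (\<lambda>p \<in> A. f p * g p) = \<chi> f * \<chi> g)}"

definition spectrum :: "'a set \<Rightarrow> ('a \<Rightarrow> complex) set \<Rightarrow> (('a \<Rightarrow> complex) \<Rightarrow> complex) variety" where
  "spectrum A B =
     \<lparr>points = algebra_homs A B,
      regular = {\<lambda>\<chi> \<in> algebra_homs A B. \<chi> b | b. b \<in> B}\<rparr>"

definition algebraic_quotient ::
    "'a variety \<Rightarrow> (complex \<Rightarrow> 'a \<Rightarrow> 'a) \<Rightarrow> (('a \<Rightarrow> complex) \<Rightarrow> complex) variety" where
  "algebraic_quotient V \<alpha> = spectrum (points V) (invariants V \<alpha>)"

definition quotient_map ::
    "'a variety \<Rightarrow> (complex \<Rightarrow> 'a \<Rightarrow> 'a) \<Rightarrow> 'a \<Rightarrow> ('a \<Rightarrow> complex) \<Rightarrow> complex" where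
  "quotient_map V \<alpha> p = (\<lambda>b \<in> invariants V \<alpha>. b p)"

text \<open>
  A morphism \<open>\<pi> : V \<rightarrow> W\<close> coincides with the algebraic quotient morphism if the two agree up to an
  isomorphism between the quotient and \<open>W\<close>.
\<close>

definition coincides_with_quotient ::
    "'a variety \<Rightarrow> (complex \<Rightarrow> 'a \<Rightarrow> 'a) \<Rightarrow> 'b variety \<Rightarrow> ('a \<Rightarrow> 'b) \<Rightarrow> bool" where
  "coincides_with_quotient V \<alpha> W \<pi> \<longleftrightarrow>
     (\<exists>\<theta>. isomorphism (algebraic_quotient V \<alpha>) W \<theta> \<and>
          (\<forall>p \<in> points V. \<theta> (quotient_map V \<alpha> p) = \<pi> p))"


section \<open>The surfaces\<close>

definition surface_S_Qn :: "poly2 \<Rightarrow> nat \<Rightarrow> point3 variety" where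
  "surface_S_Qn Q n = surface (X ^ n * Z - [:Q:])"

definition surface_S :: "point3 variety" where
  "surface_S = surface (X * (X * Z ^ 2 - 2 * Y ^ 2 * Z + 5 * Z - Y) + Y ^ 4 - 5 * Y ^ 2 + 4)"

definition derivation_D :: "poly3 \<Rightarrow> poly3" where
  "derivation_D f =
         X * (2 * X * Z - 2 * Y ^ 2 + 5) * d_dy f
       + (X + 2 * Y * (2 * X * Z - 2 * Y ^ 2 + 5)) * d_dz f"

lemma points_surface_S_Qn: "points (surface_S_Qn Q n) = {(x, y, z). x ^ n * z - eval2 Q (x, y) = 0}"
  by (auto simp: surface_S_Qn_def surface_def Let_def)

lemma points_surface_S:
  "points surface_S =
     {(x, y, z). x * (x * z ^ 2 - 2 * y ^ 2 * z + 5 * z - y) + y ^ 4 - 5 * y ^ 2 + 4 = 0}"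
  by (auto simp: surface_S_def surface_def Let_def)

end

theory Submission
  imports Defs "HOL-Computational_Algebra.Formal_Laurent_Series"
begin

text \<open>
  With \<open>u = x z - y\<^sup>2\<close> the equation of \<open>S\<close> becomes \<open>x y = (u + 1) (u + 4)\<close>, and \<open>\<partial> u = x\<^sup>2\<close>.
  So \<open>(x, u)\<close> are coordinates where \<open>x \<noteq> 0\<close>, and the coordinate ring \<open>A\<close> of \<open>S\<close> embeds into
  \<open>\<complex>((x))[u]\<close>.  It is free over \<open>\<complex>[x]\<close> with basis \<open>z\<^sup>c y\<^sup>b u\<^sup>a\<close>, \<open>a, b \<le> 1\<close>, whose elements have
  pairwise distinct degrees \<open>4 c + 2 b + a\<close> in \<open>u\<close>; this determines the semigroup of leading
  exponents of \<open>A\<close>, and forces every locally nilpotent derivation of \<open>A\<close> to kill \<open>x\<close>.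

  An isomorphism of \<open>S\<close> with \<open>x\<^sup>n z = Q(x, y)\<close> transports the derivation
  \<open>x\<^sup>n \<partial>/\<partial>y + Q\<^sub>y \<partial>/\<partial>z\<close> to \<open>A\<close>.  Hence on \<open>S\<close> the coordinate functions \<open>x'\<close>, \<open>y'\<close> of the target
  have the form \<open>p(x)\<close> and \<open>a(x) + b(x) u\<close>, and so they do not separate the components \<open>y = 1\<close> and
  \<open>y = -1\<close> of the fibre \<open>x = 0\<close>, on both of which \<open>u = -1\<close>.  A point of the target is determined
  by \<open>x'\<close> and \<open>y'\<close> unless \<open>x' = 0\<close>; in that case both components would meet the image of a single
  line, on which \<open>x\<close> and \<open>y\<close> take only finitely many values and so are constant.
\<close>

section \<open>Polynomials in three variables\<close>

text \<open>Only multiplication by single variables has to be treated, so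
  \<open>normal_form_combine\<close> never needs the product of two normal forms.\<close>

lemma poly3_module_induct [case_names const add X Y Z]:
  fixes P :: "poly3 \<Rightarrow> bool"
  assumes const: "\<And>c. P (const3 c)"
    and add: "\<And>f g. P f \<Longrightarrow> P g \<Longrightarrow> P (f + g)"
    and X: "\<And>f. P f \<Longrightarrow> P (X * f)" and Y: "\<And>f. P f \<Longrightarrow> P (Y * f)"
    and Z: "\<And>f. P f \<Longrightarrow> P (Z * f)"
  shows "P f"
proof -
  have P0: "P 0"
    using const[of 0] by (simp add: const3_def)
  have P1: "P [:[:a:]:]" for a
  proof (induction a)
    case (pCons c a)
    have "[:[:pCons c a:]:] = const3 c + X * [:[:a:]:]"
      by (simp add: const3_def X_def)
    then show ?case
      using pCons const X add by metis
  qed (use P0 in simp)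
  have P2: "P [:b:]" for b
  proof (induction b)
    case (pCons a b)
    have "[:pCons a b:] = [:[:a:]:] + Y * [:b:]"
      by (simp add: Y_def)
    then show ?case
      using pCons P1 Y add by metis
  qed (use P0 in simp)
  show ?thesis
  proof (induction f)
    case (pCons b f)
    have "pCons b f = [:b:] + Z * f"
      by (simp add: Z_def)
    then show ?case
      using pCons P2 Z add by metis
  qed (use P0 in simp)
qed

lemma poly3_induct [case_names const X Y Z add mult]:
  fixes P :: "poly3 \<Rightarrow> bool"
  assumes "\<And>c. P (const3 c)" "P X" "P Y" "P Z"
    and "\<And>f g. P f \<Longrightarrow> P g \<Longrightarrow> P (f + g)"
    and "\<And>f g. P f \<Longrightarrow> P g \<Longrightarrow> P (f * g)"
  shows "P f"
  by (induction f rule: poly3_module_induct) (simp_all add: assms)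

lemma const3_simps:
  "const3 0 = 0" "const3 1 = 1" "const3 (a + b) = const3 a + const3 b"
  "const3 (a * b) = const3 a * const3 b"
  by (simp_all add: const3_def one_pCons)

section \<open>Ring homomorphisms and substitution\<close>

definition is_ring_hom :: "('a::comm_ring_1 \<Rightarrow> 'b::comm_ring_1) \<Rightarrow> bool" where
  "is_ring_hom h \<longleftrightarrow> h 0 = 0 \<and> h 1 = 1 \<and> (\<forall>a b. h (a + b) = h a + h b) \<and> (\<forall>a b. h (a * b) = h a * h b)"

lemma is_ring_homD:
  assumes "is_ring_hom h"
  shows "h 0 = 0" "h 1 = 1" "h (a + b) = h a + h b" "h (a * b) = h a * h b"
  using assms by (auto simp: is_ring_hom_def)

lemma is_ring_hom_diff:
  assumes "is_ring_hom h"
  shows "h (a - b) = h a - h b"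
  using is_ring_homD(3)[OF assms, of "a - b" b] by (simp add: algebra_simps)

lemma is_ring_hom_power:
  assumes "is_ring_hom h"
  shows "h (a ^ n) = h a ^ n"
  by (induction n) (simp_all add: is_ring_homD[OF assms])

lemma is_ring_hom_numeral:
  assumes "is_ring_hom h"
  shows "h (numeral n) = numeral n"
proof -
  have "h (of_nat m) = of_nat m" for m
    by (induction m) (simp_all add: is_ring_homD[OF assms])
  from this[of "numeral n"] show ?thesis by simp
qed

lemma is_ring_hom_sum:
  assumes "is_ring_hom h"
  shows "h (sum f A) = (\<Sum>i\<in>A. h (f i))"
  by (induction A rule: infinite_finite_induct) (simp_all add: is_ring_homD[OF assms])

lemma is_ring_hom_map_poly:
  assumes h: "is_ring_hom h"
  shows "is_ring_hom (map_poly h)"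
  unfolding is_ring_hom_def
proof (intro conjI allI)
  note hs = is_ring_homD[OF h]
  show "map_poly h 0 = 0" by simp
  show "map_poly h 1 = 1" using hs by simp
  show add: "map_poly h (p + q) = map_poly h p + map_poly h q" for p q
    by (simp add: poly_eq_iff coeff_map_poly hs)
  show "map_poly h (p * q) = map_poly h p * map_poly h q" for p q
    by (simp add: poly_eq_iff coeff_map_poly hs coeff_mult is_ring_hom_sum[OF h])
qed

lemma is_ring_hom_poly: "is_ring_hom (\<lambda>p. poly p a)"
  by (simp add: is_ring_hom_def)

lemma is_ring_hom_comp: "is_ring_hom g \<Longrightarrow> is_ring_hom h \<Longrightarrow> is_ring_hom (\<lambda>a. g (h a))"
  by (simp add: is_ring_hom_def)

text \<open>The target ring is left arbitrary so that one construction gives both the composition of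
  polynomial maps (\<open>comp3\<close>) and the embedding \<open>rho\<close> into Laurent
  series.\<close>

definition subst3 :: "(complex \<Rightarrow> 'a::comm_ring_1) \<Rightarrow> 'a \<Rightarrow> 'a \<Rightarrow> 'a \<Rightarrow> poly3 \<Rightarrow> 'a" where
  "subst3 k x y z f =
     poly (map_poly (\<lambda>b. poly (map_poly (\<lambda>a. poly (map_poly k a) x) b) y) f) z"

lemma is_ring_hom_subst3:
  assumes "is_ring_hom k"
  shows "is_ring_hom (subst3 k x y z)"
  unfolding subst3_def
  by (rule is_ring_hom_comp[OF is_ring_hom_poly is_ring_hom_map_poly])+ (rule assms)

lemma subst3_variables:
  assumes "is_ring_hom k"
  shows "subst3 k x y z (const3 c) = k c" "subst3 k x y z X = x"
    "subst3 k x y z Y = y" "subst3 k x y z Z = z"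
  using is_ring_homD(1,2)[OF assms]
  by (simp_all add: subst3_def const3_def X_def Y_def Z_def map_poly_pCons one_pCons)

lemma is_ring_hom_const3: "is_ring_hom const3"
  by (simp add: is_ring_hom_def const3_simps)

abbreviation comp3 :: "poly3 \<Rightarrow> poly3 \<times> poly3 \<times> poly3 \<Rightarrow> poly3" where
  "comp3 f g \<equiv> subst3 const3 (fst g) (fst (snd g)) (snd (snd g)) f"

definition eval_triple :: "poly3 \<times> poly3 \<times> poly3 \<Rightarrow> point3 \<Rightarrow> point3" where
  "eval_triple \<Phi> p = (eval3 (fst \<Phi>) p, eval3 (fst (snd \<Phi>)) p, eval3 (snd (snd \<Phi>)) p)"

lemma eval3_comp3: "eval3 (comp3 f \<Phi>) p = eval3 f (eval_triple \<Phi> p)"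
  by (induction f rule: poly3_induct)
    (simp_all add: eval_triple_def subst3_variables[OF is_ring_hom_const3]
      is_ring_homD[OF is_ring_hom_subst3[OF is_ring_hom_const3]])

lemma is_ring_hom_eval3: "is_ring_hom (\<lambda>f. eval3 f p)"
  unfolding is_ring_hom_def using eval3_simps(7)[of 0] by (simp add: const3_simps)

lemma eval3_smult [simp]: "eval3 (smult R f) p = eval2 R (fst p, fst (snd p)) * eval3 f p"
  using eval3_simps(3)[of "[:R:]" f p] by simp

lemma eval2_simps [simp]:
  "eval2 (P + Q) p = eval2 P p + eval2 Q p"
  "eval2 (P - Q) p = eval2 P p - eval2 Q p"
  "eval2 (P * Q) p = eval2 P p * eval2 Q p"
  "eval2 (P ^ k) p = eval2 P p ^ k"
  "eval2 0 p = 0" "eval2 1 p = 1"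
  "eval2 [:a:] p = poly a (fst p)"
  "eval2 [:0, 1:] p = snd p"
  "eval2 (numeral m) p = numeral m"
  "eval2 (smult a P) p = poly a (fst p) * eval2 P p"
  "eval2 (pCons a P) p = poly a (fst p) + snd p * eval2 P p"
  by (simp_all add: eval2_def split_beta)

text \<open>Each coefficient in the outer variable is a polynomial in x with infinitely many roots.
  Leaving out x = 0 matters because the chart of S exists only for nonzero x.\<close>

lemma eval2_eq_0:
  assumes "\<And>x u. x \<noteq> 0 \<Longrightarrow> eval2 G (x, u) = 0"
  shows "G = 0"
proof (rule ccontr)
  assume "G \<noteq> 0"
  have *: "poly (map_poly (\<lambda>a. poly a x) G) u = eval2 G (x, u)" for x u
    by (induction G) (simp_all add: map_poly_pCons)
  have "coeff (map_poly (\<lambda>a. poly a x) G) n = 0" if "x \<noteq> 0" for x n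
    using * assms[OF that] poly_all_0_iff_0 by (metis coeff_0)
  hence "poly (coeff G n) x = 0" if "x \<noteq> 0" for x n
    using that by (simp add: coeff_map_poly)
  hence "-{0} \<subseteq> {x. poly (coeff G n) x = 0}" for n
    by auto
  moreover have "infinite (-{0::complex})"
    by (simp add: Compl_eq_Diff_UNIV infinite_UNIV_char_0)
  ultimately have "coeff G n = 0" for n
    using poly_roots_finite finite_subset by metis
  thus False using \<open>G \<noteq> 0\<close> by (simp add: poly_eq_iff)
qed


section \<open>Derivations\<close>

text \<open>Acting on coefficients keeps the outer variable constant. This serves the partial
  derivative in y of C[x][y][z] and the derivative in x of C((x))[u].\<close>

lemma map_poly_derivation:
  fixes d :: "'a::comm_ring_1 \<Rightarrow> 'a"
  assumes d0: "d 0 = 0" and add: "\<And>a b. d (a + b) = d a + d b"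
    and mult: "\<And>a b. d (a * b) = a * d b + d a * b"
  shows "map_poly d (p + q) = map_poly d p + map_poly d q"
    and "map_poly d (p * q) = p * map_poly d q + q * map_poly d p"
proof -
  have sum: "d (sum f A) = (\<Sum>i\<in>A. d (f i))" for f and A :: "nat set"
    by (induction A rule: infinite_finite_induct) (simp_all add: d0 add)
  show "map_poly d (p + q) = map_poly d p + map_poly d q"
    by (simp add: poly_eq_iff coeff_map_poly d0 add)
  have "map_poly d (p * q) = p * map_poly d q + map_poly d p * q"
    by (simp add: poly_eq_iff coeff_map_poly d0 coeff_mult sum mult sum.distrib)
  thus "map_poly d (p * q) = p * map_poly d q + q * map_poly d p"
    by (simp add: mult.commute)
qed

lemma d_dy_simps [simp]:
  "d_dy (f + g) = d_dy f + d_dy g" "d_dy (f * g) = f * d_dy g + g * d_dy f"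
  "d_dy (const3 c) = 0" "d_dy [:Q:] = [:pderiv Q:]" "d_dy X = 0" "d_dy Y = 1" "d_dy Z = 0"
  using map_poly_derivation[of "pderiv :: poly2 \<Rightarrow> poly2"]
  by (simp_all add: d_dy_def pderiv_add pderiv_mult mult.commute const3_def partial_derivatives_of_variables
      flip: d_dy_def)
    (simp_all add: d_dy_def map_poly_pCons pderiv_pCons)

lemma d_dz_simps [simp]:
  "d_dz (f + g) = d_dz f + d_dz g" "d_dz (f * g) = f * d_dz g + g * d_dz f"
  "d_dz (const3 c) = 0" "d_dz [:Q:] = 0" "d_dz X = 0" "d_dz Y = 0" "d_dz Z = 1"
  by (simp_all add: d_dz_def pderiv_add pderiv_mult const3_def X_def Y_def Z_def pderiv_pCons
      one_pCons)

lemma derivation_yz: "derivation (\<lambda>f. a * d_dy f + b * d_dz f)"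
  by (simp add: derivation_def algebra_simps)

lemma derivationD:
  assumes "derivation D"
  shows "D (f + g) = D f + D g" "D (f * g) = f * D g + g * D f" "D (const3 c) = 0" "D 0 = 0"
  using assms unfolding derivation_def by (auto simp flip: const3_simps(1))

lemma derivation_iter:
  assumes "derivation D"
  shows "(D ^^ m) (f + g) = (D ^^ m) f + (D ^^ m) g" "(D ^^ m) 0 = 0"
  by (induction m) (simp_all add: derivationD[OF assms])

lemma derivation_nilpotent_mono:
  assumes "derivation D" and "(D ^^ m) f = 0" and "m \<le> n"
  shows "(D ^^ n) f = 0"
proof -
  have "(D ^^ n) f = (D ^^ (n - m)) ((D ^^ m) f)"
    using assms(3) by (metis comp_apply funpow_add le_add_diff_inverse2)
  thus ?thesis using assms derivation_iter by simp
qed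

text \<open>Each summand of D (f g) = f D g + g D f lowers one of the two nilpotency exponents, so
  induction on their sum replaces the binomial expansion.\<close>

lemma derivation_nilpotent_mult:
  assumes D: "derivation D"
  shows "(D ^^ m) f = 0 \<Longrightarrow> (D ^^ n) g = 0 \<Longrightarrow> (D ^^ (m + n)) (f * g) = 0"
proof (induction "m + n" arbitrary: m n f g)
  case (Suc k)
  show ?case
  proof (cases "m = 0 \<or> n = 0")
    case True
    thus ?thesis using Suc.prems derivation_iter[OF D] by auto
  next
    case False
    then obtain m' n' where [simp]: "m = Suc m'" "n = Suc n'"
      by (meson not0_implies_Suc)
    have "(D ^^ (m + n')) (f * D g) = 0"
      using Suc.prems Suc.hyps(2) by (intro Suc.hyps(1)) (simp_all add: funpow_Suc_right del: funpow.simps)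
    moreover have "(D ^^ (n + m')) (g * D f) = 0"
      using Suc.prems Suc.hyps(2) by (intro Suc.hyps(1)) (simp_all add: funpow_Suc_right del: funpow.simps)
    ultimately have "(D ^^ (m + n')) (D (f * g)) = 0"
      by (simp add: derivationD[OF D] derivation_iter[OF D] add.commute del: funpow.simps)
    thus ?thesis by (simp add: funpow_Suc_right del: funpow.simps)
  qed
qed (use derivation_iter[OF D] in auto)

text \<open>The elements killed by some power of D form a subalgebra, so the generators
  suffice.\<close>

lemma locally_nilpotentI:
  assumes D: "derivation D" and "(D ^^ k) X = 0" "(D ^^ l) Y = 0" "(D ^^ m) Z = 0"
  shows "locally_nilpotent_derivation D"
proof -
  have "\<exists>m. (D ^^ m) f = 0" for f
  proof (induction f rule: poly3_induct)
    case (const c)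
    show ?case by (rule exI[of _ 1]) (simp add: derivationD[OF D])
  next
    case (add f g)
    then obtain i j where "(D ^^ i) f = 0" "(D ^^ j) g = 0" by auto
    hence "(D ^^ (max i j)) (f + g) = 0"
      using derivation_nilpotent_mono[OF D, of i f "max i j"]
        derivation_nilpotent_mono[OF D, of j g "max i j"]
      by (simp add: derivation_iter[OF D])
    thus ?case ..
  next
    case (mult f g)
    thus ?case using derivation_nilpotent_mult[OF D] by blast
  qed (use assms in auto)
  thus ?thesis using D by (simp add: locally_nilpotent_derivation_def)
qed

text \<open>The chain rule with x fixed ties the formal partial derivatives to functions on a
  surface; \<open>\<delta>_vanishes_generically\<close> relies on it.\<close>

lemma eval3_has_field_derivative:
  assumes "(b has_field_derivative b') (at t)" "(c has_field_derivative c') (at t)"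
  shows "((\<lambda>t. eval3 f (x, b t, c t)) has_field_derivative
    eval3 (d_dy f) (x, b t, c t) * b' + eval3 (d_dz f) (x, b t, c t) * c') (at t)"
proof (induction f rule: poly3_induct)
  case (add f g)
  show ?case using DERIV_add[OF add] by (simp add: algebra_simps)
next
  case (mult f g)
  show ?case using DERIV_mult[OF mult] by (simp add: algebra_simps)
qed (use assms is_ring_homD(1)[OF is_ring_hom_eval3] in simp_all)


unbundle fps_syntax

section \<open>The coordinate ring inside \<open>\<complex>((x))[u]\<close>\<close>

text \<open>Laurent series instead of C[x, 1/x]: the coefficients then form a field, with an order
  and a derivative in x.\<close>

type_synonym laurent = "complex fls poly"

definition lx :: laurent where "lx = [:fls_X:]"
definition lx_inv :: laurent where "lx_inv = [:fls_X_inv:]"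
definition lu :: laurent where "lu = [:0, 1:]"
text \<open>Obtained by solving x y = (u + 1) (u + 4) for y and then u = x z - y^2 for z;
  \<open>chart\<close> uses the same formulas at points.\<close>

definition ly :: laurent where "ly = lx_inv * ((lu + 1) * (lu + 4))"
definition lz :: laurent where "lz = lx_inv * (ly ^ 2 + lu)"

definition rho :: "poly3 \<Rightarrow> laurent" where
  "rho = subst3 (\<lambda>c. [:fls_const c:]) lx ly lz"

definition U :: poly3 where "U = X * Z - Y ^ 2"

definition u_coord :: "point3 \<Rightarrow> complex" where
  "u_coord p = fst p * snd (snd p) - fst (snd p) ^ 2"

definition chart :: "complex \<Rightarrow> complex \<Rightarrow> point3" where
  "chart x u = (let y = (u + 1) * (u + 4) / x in (x, y, (y ^ 2 + u) / x))"

lemma eval3_U [simp]: "eval3 U p = u_coord p"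
  by (simp add: U_def u_coord_def)

lemma mem_S_iff:
  "p \<in> points surface_S \<longleftrightarrow> (u_coord p + 1) * (u_coord p + 4) = fst p * fst (snd p)"
proof -
  obtain x y z where p: "p = (x, y, z)" by (cases p)
  have "x * (x * z ^ 2 - 2 * y ^ 2 * z + 5 * z - y) + y ^ 4 - 5 * y ^ 2 + 4
      = (u_coord p + 1) * (u_coord p + 4) - x * y"
    unfolding p u_coord_def by (simp add: algebra_simps power2_eq_square power4_eq_xxxx)
  thus ?thesis by (simp add: p points_surface_S)
qed

lemma chart_in_S: "x \<noteq> 0 \<Longrightarrow> chart x u \<in> points surface_S"
  and u_coord_chart: "x \<noteq> 0 \<Longrightarrow> u_coord (chart x u) = u"
  and fst_chart: "fst (chart x u) = x"
proof -
  show *: "u_coord (chart x u) = u" if "x \<noteq> 0"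
    using that by (simp add: u_coord_def chart_def Let_def)
  show "chart x u \<in> points surface_S" if "x \<noteq> 0"
    unfolding mem_S_iff *[OF that] using that by (simp add: chart_def Let_def)
  show "fst (chart x u) = x"
    by (simp add: chart_def Let_def)
qed

lemma chart_u_coord:
  assumes "p \<in> points surface_S" "fst p \<noteq> 0"
  shows "chart (fst p) (u_coord p) = p"
proof -
  obtain x y z where p: "p = (x, y, z)" by (cases p)
  have "(u_coord p + 1) * (u_coord p + 4) / x = y"
    using assms by (simp add: mem_S_iff p)
  moreover have "(y ^ 2 + u_coord p) / x = z"
    using assms by (simp add: u_coord_def p)
  ultimately show ?thesis by (simp add: chart_def p)
qed

lemma is_ring_hom_const_laurent: "is_ring_hom (\<lambda>c. [:fls_const c:] :: laurent)"
  by (simp add: is_ring_hom_def one_pCons fls_plus_const mult.commute)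

lemmas is_ring_hom_rho = is_ring_hom_subst3[OF is_ring_hom_const_laurent, of lx ly lz, folded rho_def]
lemmas rho_simps = is_ring_homD[OF is_ring_hom_rho]
  is_ring_hom_diff[OF is_ring_hom_rho] is_ring_hom_power[OF is_ring_hom_rho]
  is_ring_hom_numeral[OF is_ring_hom_rho]
  subst3_variables[OF is_ring_hom_const_laurent, of lx ly lz, folded rho_def]

lemma lx_lx_inv [simp]: "lx * lx_inv = 1" "lx_inv * lx = 1"
  "lx * (lx_inv * g) = g" "lx_inv * (lx * g) = g"
proof -
  have *: "fls_X * fls_X_inv = (1 :: complex fls)"
    unfolding fls_X_times_conv_shift by simp
  show 1: "lx * lx_inv = 1" using * by (simp add: lx_def lx_inv_def one_pCons mult.commute)
  thus 2: "lx_inv * lx = 1" by (simp add: mult.commute)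
  show "lx * (lx_inv * g) = g" "lx_inv * (lx * g) = g"
    using 1 2 by (simp_all flip: mult.assoc)
qed

lemma lx_nonzero [simp]: "lx \<noteq> 0"
  by (simp add: lx_def)

lemma lx_ly: "lx * ly = (lu + 1) * (lu + 4)"
  by (simp add: ly_def)

lemma lx_lz: "lx * lz = ly ^ 2 + lu"
  by (simp add: lz_def)

lemma rho_U: "rho U = lu"
  by (simp add: U_def rho_simps lx_lz)

section \<open>From values on the chart to Laurent series\<close>

definition fls_of_poly :: "complex poly \<Rightarrow> complex fls" where
  "fls_of_poly p = fps_to_fls (fps_of_poly p)"

lemma is_ring_hom_fls_of_poly: "is_ring_hom fls_of_poly"
  by (simp add: is_ring_hom_def fls_of_poly_def fps_of_poly_add fps_of_poly_mult fls_times_fps_to_fls)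

lemma fls_of_poly_eq_0_iff [simp]: "fls_of_poly p = 0 \<longleftrightarrow> p = 0"
  using fps_of_poly_eq_iff[of p 0] by (simp add: fls_of_poly_def)

lemma fls_of_poly_nth_neg: "i < 0 \<Longrightarrow> fls_of_poly p $$ i = 0"
  by (simp add: fls_of_poly_def)

lemma fls_of_poly_simps [simp]:
  "fls_of_poly 0 = 0" "fls_of_poly 1 = 1" "fls_of_poly [:0, 1:] = fls_X" "fls_of_poly [:c:] = fls_const c"
  by (simp_all add: fls_of_poly_def fps_of_poly_const)

lemma fls_of_poly_pCons: "fls_of_poly (pCons c p) = fls_const c + fls_X * fls_of_poly p"
proof -
  have "pCons c p = [:c:] + [:0, 1:] * p" by simp
  hence "fls_of_poly (pCons c p) = fls_of_poly [:c:] + fls_of_poly [:0, 1:] * fls_of_poly p"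
    using is_ring_homD(3,4)[OF is_ring_hom_fls_of_poly] by metis
  thus ?thesis by simp
qed

lemma rho_poly_x: "rho [:[:p:]:] = [:fls_of_poly p:]"
proof (induction p)
  case 0
  show ?case using rho_simps(1) by simp
next
  case (pCons c p)
  have "rho [:[:pCons c p:]:] = rho (const3 c + X * [:[:p:]:])"
    by (simp add: const3_def X_def)
  also have "\<dots> = [:fls_const c:] + lx * [:fls_of_poly p:]"
    by (simp only: rho_simps pCons)
  finally show ?case
    by (simp add: lx_def fls_of_poly_pCons mult.commute)
qed

text \<open>The bridge between geometry and algebra: one polynomial G in (x, u) describes both
  \<open>rho f\<close> and the values of f on the chart, up to the same power of x.\<close>

lemma rho_clear_denominator:
  "\<exists>N G. lx ^ N * rho f = map_poly fls_of_poly G \<and>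
     (\<forall>x u. x \<noteq> 0 \<longrightarrow> eval2 G (x, u) = x ^ N * eval3 f (chart x u))"
proof -
  note hom = is_ring_hom_map_poly[OF is_ring_hom_fls_of_poly]
  note hom' = is_ring_homD[OF hom] is_ring_hom_diff[OF hom] is_ring_hom_power[OF hom]
    is_ring_hom_numeral[OF hom]
  define x2 u2 :: poly2 where "x2 = [:[:0, 1:]:]" and "u2 = [:0, 1:]"
  have [simp]: "map_poly fls_of_poly x2 = lx" "map_poly fls_of_poly u2 = lu"
    by (simp_all add: x2_def u2_def lx_def lu_def map_poly_pCons)
  have [simp]: "eval2 x2 p = fst p" "eval2 u2 p = snd p" for p
    by (simp_all add: x2_def u2_def)
  show ?thesis
  proof (induction f rule: poly3_induct)
    case (const c)
    show ?case
      by (rule exI[of _ 0], rule exI[of _ "[:[:c:]:]"]) (simp add: rho_simps map_poly_pCons)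
  next
    case X
    show ?case
      by (rule exI[of _ 0], rule exI[of _ x2]) (simp add: rho_simps fst_chart)
  next
    case Y
    show ?case
      by (rule exI[of _ 1], rule exI[of _ "(u2 + 1) * (u2 + 4)"])
        (simp add: rho_simps hom' lx_ly chart_def Let_def)
  next
    case Z
    \<comment> \<open>In z = (y^2 + u) / x the square of y has a double pole in x and the division
      adds one more, hence the exponent 3.\<close>
    have "lx ^ 3 * lz = (lx * ly) ^ 2 + lx ^ 2 * lu"
      by (simp add: power3_eq_cube power2_eq_square lx_lz mult.assoc) (simp add: algebra_simps)
    moreover have "((u + 1) * (u + 4)) ^ 2 + x ^ 2 * u
        = x ^ 3 * ((((u + 1) * (u + 4) / x) ^ 2 + u) / x)" if "x \<noteq> 0" for x u :: complex
      using that by (simp add: power3_eq_cube power2_eq_square field_simps)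
    ultimately show ?case
      by (intro exI[of _ 3] exI[of _ "((u2 + 1) * (u2 + 4)) ^ 2 + x2 ^ 2 * u2"])
        (simp add: rho_simps hom' lx_ly chart_def Let_def)
  next
    case (add f g)
    then obtain N G M H where 1: "lx ^ N * rho f = map_poly fls_of_poly G"
        "lx ^ M * rho g = map_poly fls_of_poly H"
      and 2: "\<forall>x u. x \<noteq> 0 \<longrightarrow> eval2 G (x, u) = x ^ N * eval3 f (chart x u)"
        "\<forall>x u. x \<noteq> 0 \<longrightarrow> eval2 H (x, u) = x ^ M * eval3 g (chart x u)"
      by blast
    have "lx ^ (N + M) * rho (f + g) = map_poly fls_of_poly (x2 ^ M * G + x2 ^ N * H)"
      by (simp add: hom' rho_simps power_add distrib_left mult.assoc mult.left_commute flip: 1)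
    moreover have "\<forall>x u. x \<noteq> 0 \<longrightarrow> eval2 (x2 ^ M * G + x2 ^ N * H) (x, u)
        = x ^ (N + M) * eval3 (f + g) (chart x u)"
      using 2 by (simp add: power_add algebra_simps)
    ultimately show ?case by blast
  next
    case (mult f g)
    then obtain N G M H where 1: "lx ^ N * rho f = map_poly fls_of_poly G"
        "lx ^ M * rho g = map_poly fls_of_poly H"
      and 2: "\<forall>x u. x \<noteq> 0 \<longrightarrow> eval2 G (x, u) = x ^ N * eval3 f (chart x u)"
        "\<forall>x u. x \<noteq> 0 \<longrightarrow> eval2 H (x, u) = x ^ M * eval3 g (chart x u)"
      by blast
    have "lx ^ (N + M) * rho (f * g) = map_poly fls_of_poly (G * H)"
      by (simp add: hom' rho_simps power_add mult.assoc mult.left_commute flip: 1)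
    moreover have "\<forall>x u. x \<noteq> 0 \<longrightarrow> eval2 (G * H) (x, u) = x ^ (N + M) * eval3 (f * g) (chart x u)"
      using 2 by (simp add: power_add)
    ultimately show ?case by blast
  qed
qed

text \<open>The points with nonzero x already force G = 0. With the converse
  \<open>rho_eq_0_imp\<close>, the kernel of \<open>rho\<close> is the ideal of S, so the image of
  \<open>rho\<close> is a model of the coordinate ring.\<close>

lemma rho_eq_0:
  assumes "\<And>p. p \<in> points surface_S \<Longrightarrow> eval3 f p = 0"
  shows "rho f = 0"
proof -
  obtain N G where G: "lx ^ N * rho f = map_poly fls_of_poly G"
    "\<forall>x u. x \<noteq> 0 \<longrightarrow> eval2 G (x, u) = x ^ N * eval3 f (chart x u)"
    using rho_clear_denominator by blast
  have "G = 0"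
    using G(2) assms chart_in_S by (intro eval2_eq_0) simp
  hence "lx ^ N * rho f = 0" using G(1) by simp
  thus ?thesis by simp
qed

lemma rho_cong:
  assumes "\<And>p. p \<in> points surface_S \<Longrightarrow> eval3 f p = eval3 g p"
  shows "rho f = rho g"
  using rho_eq_0[of "f - g"] assms by (simp add: rho_simps)


subsection \<open>A basis over \<open>\<complex>[x]\<close>\<close>

text \<open>The index is j = 4 c + 2 b + a for z^c y^b u^a, which makes it equal to the degree in
  u.\<close>

definition basis :: "nat \<Rightarrow> poly3" where
  "basis j = Z ^ (j div 4) * (if even j then 1 else U) * (if j mod 4 < 2 then 1 else Y)"

text \<open>The second variable of the coefficients stands for z here: 1, u, y, u y generate the
  coordinate ring as a module over C[x, z].\<close>

definition combine :: "poly2 \<Rightarrow> poly2 \<Rightarrow> poly2 \<Rightarrow> poly2 \<Rightarrow> point3 \<Rightarrow> complex" where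
  "combine r0 r1 r2 r3 p = (let q = (fst p, snd (snd p)); u = u_coord p; y = fst (snd p) in
     eval2 r0 q + u * eval2 r1 q + y * eval2 r2 q + u * y * eval2 r3 q)"

text \<open>Only multiplication by y leaves the span of 1, u, y, u y; the relations y^2 = x z - u
  and u^2 = x y - 5 u - 4 on S lead back into it.\<close>

lemma normal_form_combine:
  "\<exists>r0 r1 r2 r3. \<forall>p \<in> points surface_S. eval3 f p = combine r0 r1 r2 r3 p"
proof (induction f rule: poly3_module_induct)
  case (const c)
  show ?case
    by (rule exI[of _ "[:[:c:]:]"], (rule exI[of _ 0])+) (simp add: combine_def)
next
  case (add f g)
  then obtain r0 r1 r2 r3 s0 s1 s2 s3 where
    "\<forall>p \<in> points surface_S. eval3 f p = combine r0 r1 r2 r3 p"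
    "\<forall>p \<in> points surface_S. eval3 g p = combine s0 s1 s2 s3 p"
    by blast
  thus ?case
    by (intro exI[of _ "r0 + s0"] exI[of _ "r1 + s1"] exI[of _ "r2 + s2"] exI[of _ "r3 + s3"])
      (simp add: combine_def Let_def algebra_simps)
next
  case (X f)
  then obtain r0 r1 r2 r3 where "\<forall>p \<in> points surface_S. eval3 f p = combine r0 r1 r2 r3 p"
    by blast
  thus ?case
    by (intro exI[of _ "[:[:0,1:]:] * r0"] exI[of _ "[:[:0,1:]:] * r1"]
        exI[of _ "[:[:0,1:]:] * r2"] exI[of _ "[:[:0,1:]:] * r3"])
      (simp add: combine_def Let_def algebra_simps)
next
  case (Z f)
  then obtain r0 r1 r2 r3 where "\<forall>p \<in> points surface_S. eval3 f p = combine r0 r1 r2 r3 p"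
    by blast
  thus ?case
    by (intro exI[of _ "[:0,1:] * r0"] exI[of _ "[:0,1:] * r1"]
        exI[of _ "[:0,1:] * r2"] exI[of _ "[:0,1:] * r3"])
      (simp add: combine_def Let_def algebra_simps)
next
  case (Y f)
  then obtain r0 r1 r2 r3 where *: "\<forall>p \<in> points surface_S. eval3 f p = combine r0 r1 r2 r3 p"
    by blast
  define x2 z2 :: poly2 where "x2 = [:[:0, 1:]:]" and "z2 = [:0, 1:]"
  have [simp]: "eval2 x2 p = fst p" "eval2 z2 p = snd p" for p
    by (simp_all add: x2_def z2_def)
  have eq: "y * (a + u * b + y * c + u * y * d)
      = (x * z * c + 4 * d) + u * ((x * z + 5) * d - c) + y * (a - x * d) + u * y * b"
    if "(u + 1) * (u + 4) = x * y" "y * y = x * z - u" for x y z u a b c d :: complex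
  proof -
    have "y * (a + u * b + y * c + u * y * d) = y * a + u * y * b + (y * y) * c + u * (y * y) * d"
      by (simp add: algebra_simps)
    also have "\<dots> = y * a + u * y * b + (x * z - u) * c + (x * z * u - (x * y - 5 * u - 4)) * d"
      unfolding that(2) that(1)[symmetric] by (simp add: algebra_simps)
    finally show ?thesis by (simp add: algebra_simps)
  qed
  have "eval3 (Y * f) p
      = combine (x2 * z2 * r2 + 4 * r3) ((x2 * z2 + 5) * r3 - r2) (r0 - x2 * r3) r1 p"
    if "p \<in> points surface_S" for p
    using * that eq[of "u_coord p" "fst p" "fst (snd p)" "snd (snd p)"]
    by (simp add: mem_S_iff combine_def Let_def) (simp add: u_coord_def power2_eq_square)
  thus ?case by blast
qed

lemma eval2_altdef:
  assumes "degree r < N"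
  shows "eval2 r (x, z) = (\<Sum>k<N. poly (coeff r k) x * z ^ k)"
proof -
  have "eval2 r (x, z) = (\<Sum>k\<le>degree r. poly (coeff r k) x * z ^ k)"
    by (simp add: eval2_def poly_altdef[of r] poly_sum poly_power)
  also have "\<dots> = (\<Sum>k<N. poly (coeff r k) x * z ^ k)"
    using assms by (intro sum.mono_neutral_left) (auto simp: coeff_eq_0)
  finally show ?thesis .
qed

lemma sum_mod_4:
  fixes f :: "nat \<Rightarrow> 'a::comm_monoid_add"
  shows "(\<Sum>j<4 * N. f j) = (\<Sum>k<N. f (4 * k) + f (4 * k + 1) + f (4 * k + 2) + f (4 * k + 3))"
proof (induction N)
  case (Suc N)
  have "4 * Suc N = Suc (Suc (Suc (Suc (4 * N))))" by simp
  thus ?case using Suc by (simp add: add.assoc numeral_eq_Suc)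
qed simp

lemma normal_form_S:
  "\<exists>N c. \<forall>p \<in> points surface_S. eval3 f p = (\<Sum>j<N. poly (c j) (fst p) * eval3 (basis j) p)"
proof -
  obtain r0 r1 r2 r3 where
    r: "\<forall>p \<in> points surface_S. eval3 f p = combine r0 r1 r2 r3 p"
    using normal_form_combine by blast
  define N where "N = Suc (degree r0 + degree r1 + degree r2 + degree r3)"
  \<comment> \<open>As in \<open>basis\<close>, the remainder mod 4 selects one of 1, u, y, u y and
    the quotient is the power of z.\<close>
  define c where "c j = coeff ([r0, r1, r2, r3] ! (j mod 4)) (j div 4)" for j
  have "eval3 f p = (\<Sum>j<4 * N. poly (c j) (fst p) * eval3 (basis j) p)"
    if p: "p \<in> points surface_S" for p
  proof -
    define x where "x = fst p"
    define y where "y = fst (snd p)"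
    define z where "z = snd (snd p)"
    define u where "u = u_coord p"
    note defs = x_def y_def z_def u_def
    have dm: "(4 * k) div 4 = k" "(4 * k + 1) div 4 = k" "(4 * k + 2) div 4 = k" "(4 * k + 3) div 4 = k"
      "(4 * k) mod 4 = 0" "(4 * k + 1) mod 4 = 1" "(4 * k + 2) mod 4 = 2" "(4 * k + 3) mod 4 = 3"
      "even (4 * k)" "odd (4 * k + 1)" "even (4 * k + 2)" "odd (4 * k + 3)" for k :: nat
      by presburger+
    have nth: "[r0, r1, r2, r3] ! 0 = r0" "[r0, r1, r2, r3] ! 1 = r1"
        "[r0, r1, r2, r3] ! 2 = r2" "[r0, r1, r2, r3] ! 3 = r3"
      by simp_all
    have c: "c (4 * k) = coeff r0 k" "c (4 * k + 1) = coeff r1 k"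
        "c (4 * k + 2) = coeff r2 k" "c (4 * k + 3) = coeff r3 k" for k
      unfolding c_def dm nth by (rule refl)+
    have b: "eval3 (basis (4 * k)) p = z ^ k" "eval3 (basis (4 * k + 1)) p = z ^ k * u"
        "eval3 (basis (4 * k + 2)) p = z ^ k * y" "eval3 (basis (4 * k + 3)) p = z ^ k * u * y" for k
      unfolding basis_def dm(1-8) using dm(9-12)[of k] by (simp_all add: defs)
    have "(\<Sum>j<4 * N. poly (c j) (fst p) * eval3 (basis j) p)
        = (\<Sum>k<N. poly (coeff r0 k) x * z ^ k) + u * (\<Sum>k<N. poly (coeff r1 k) x * z ^ k)
        + y * (\<Sum>k<N. poly (coeff r2 k) x * z ^ k) + u * y * (\<Sum>k<N. poly (coeff r3 k) x * z ^ k)"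
      unfolding sum_mod_4 c b
      by (simp add: sum.distrib sum_distrib_left defs mult_ac distrib_left distrib_right)
    also have "\<dots> = eval2 r0 (x, z) + u * eval2 r1 (x, z) + y * eval2 r2 (x, z) + u * y * eval2 r3 (x, z)"
      by (simp add: eval2_altdef[of _ N] N_def)
    finally show ?thesis
      using r p by (simp add: defs combine_def Let_def)
  qed
  thus ?thesis by blast
qed

text \<open>The same coefficients occur at points and under \<open>rho\<close>, so what degrees in u
  say about them holds at all points of S, including those with x = 0.\<close>

lemma normal_form:
  "\<exists>c N. (\<forall>p \<in> points surface_S. eval3 f p = (\<Sum>j<N. poly (c j) (fst p) * eval3 (basis j) p)) \<and>
     rho f = (\<Sum>j<N. [:fls_of_poly (c j):] * rho (basis j))"
proof -
  obtain N c where *: "\<And>p. p \<in> points surface_S \<Longrightarrow>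
      eval3 f p = (\<Sum>j<N. poly (c j) (fst p) * eval3 (basis j) p)"
    using normal_form_S by blast
  hence "eval3 f p = eval3 (\<Sum>j<N. [:[:c j:]:] * basis j) p" if "p \<in> points surface_S" for p
    using *[OF that] by (simp add: is_ring_hom_sum[OF is_ring_hom_eval3])
  hence "rho f = rho (\<Sum>j<N. [:[:c j:]:] * basis j)"
    by (rule rho_cong)
  hence "rho f = (\<Sum>j<N. [:fls_of_poly (c j):] * rho (basis j))"
    by (simp only: is_ring_hom_sum[OF is_ring_hom_rho] rho_simps(4) rho_poly_x)
  with * show ?thesis by blast
qed

text \<open>The pole order in x of the leading coefficient of \<open>rho (basis j)\<close>: every
  factor z contributes 3, a factor y contributes 1, and u nothing.\<close>

definition pole :: "nat \<Rightarrow> nat" where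
  "pole j = 3 * (j div 4) + (if j mod 4 < 2 then 0 else 1)"

lemma rho_basis:
  shows degree_rho_basis: "degree (rho (basis j)) = j"
    and lead_coeff_rho_basis: "coeff (rho (basis j)) j = fls_X_inv ^ pole j"
proof -
  define a :: "complex fls" where "a = fls_X_inv"
  have a: "a \<noteq> 0" by (simp add: a_def)
  have ly: "ly = [:4 * a, 5 * a, a:]"
    by (simp add: ly_def lu_def lx_inv_def a_def one_pCons numeral_poly algebra_simps)
  have lz: "lz = [:16 * a ^ 3, 40 * a ^ 3 + a, 33 * a ^ 3, 10 * a ^ 3, a ^ 3:]"
    unfolding lz_def ly by (simp add: lx_inv_def lu_def a_def power2_eq_square power3_eq_cube algebra_simps)
  have dy: "degree ly = 2" "lead_coeff ly = a" and dz: "degree lz = 4" "lead_coeff lz = a ^ 3"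
    and du: "degree lu = 1" "lead_coeff lu = 1"
    using a by (simp_all add: ly lz lu_def)
  have nz: "ly \<noteq> 0" "lz \<noteq> 0" "lu \<noteq> 0"
    using a by (auto simp: ly lz lu_def)
  have rho: "rho (basis j) = lz ^ (j div 4) * (if even j then 1 else lu) * (if j mod 4 < 2 then 1 else ly)"
    by (simp add: basis_def rho_simps rho_U)
  have j: "j = 4 * (j div 4) + j mod 4" by simp
  have m: "j mod 4 = 0 \<and> even j \<or> j mod 4 = 1 \<and> odd j \<or> j mod 4 = 2 \<and> even j \<or> j mod 4 = 3 \<and> odd j"
    by presburger
  have "degree (rho (basis j)) = 4 * (j div 4) + j mod 4"
    unfolding rho using m nz by (auto simp: degree_mult_eq degree_power_eq dy dz du) presburger+
  thus d: "degree (rho (basis j)) = j" by simp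
  have "lead_coeff (rho (basis j)) = a ^ pole j"
    unfolding rho lead_coeff_mult lead_coeff_power
    using dy(2)[unfolded dy(1)] dz(2)[unfolded dz(1)] du(2)[unfolded du(1)]
    by (simp add: dy(1) dz(1) du(1) pole_def power_add power_mult)
  thus "coeff (rho (basis j)) j = fls_X_inv ^ pole j"
    by (simp add: d a_def)
qed

text \<open>With pairwise distinct degrees nothing cancels at the top, so the coefficients vanish
  one by one from the largest index downwards. The zero sum is separate because its degree 0 gives
  no information about \<open>c 0\<close>.\<close>

lemma triangular_sum_degree:
  fixes e :: "nat \<Rightarrow> 'a::idom poly"
  assumes e: "\<And>j. degree (e j) = j" "\<And>j. e j \<noteq> 0"
  shows "degree (\<Sum>j<N. [:c j:] * e j) < k \<Longrightarrow> k < N \<Longrightarrow> c k = 0"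
    and "(\<Sum>j<N. [:c j:] * e j) = 0 \<Longrightarrow> k < N \<Longrightarrow> c k = 0"
proof -
  have "c k = 0" if "coeff (\<Sum>j<N. [:c j:] * e j) k = 0" "\<And>i. k < i \<Longrightarrow> i < N \<Longrightarrow> c i = 0" "k < N" for k
  proof -
    have "coeff (\<Sum>j<N. [:c j:] * e j) k = (\<Sum>j<N. c j * coeff (e j) k)"
      by (simp add: coeff_sum)
    also have "\<dots> = (\<Sum>j\<in>{k}. c j * coeff (e j) k)"
    proof (rule sum.mono_neutral_right)
      show "\<forall>i\<in>{..<N} - {k}. c i * coeff (e i) k = 0"
        using that(2) e(1) by (metis Diff_iff coeff_eq_0 insertCI lessThan_iff linorder_neqE_nat
            mult_eq_0_iff)
    qed (use that(3) in auto)
    finally have "c k * coeff (e k) k = 0"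
      using that(1) by simp
    moreover have "coeff (e k) k \<noteq> 0"
      using e[of k] by (metis leading_coeff_0_iff)
    ultimately show ?thesis by simp
  qed note * = this
  show "c k = 0" if "degree (\<Sum>j<N. [:c j:] * e j) < k" "k < N" for k
    using that
  proof (induction "N - k" arbitrary: k rule: less_induct)
    case less
    show ?case by (rule *) (use less in \<open>auto intro: coeff_eq_0\<close>)
  qed
  show "c k = 0" if "(\<Sum>j<N. [:c j:] * e j) = 0" "k < N" for k
    using that
  proof (induction "N - k" arbitrary: k rule: less_induct)
    case less
    show ?case by (rule *) (use less in \<open>auto\<close>)
  qed
qed

lemma rho_basis_nonzero: "rho (basis j) \<noteq> 0"
  using lead_coeff_rho_basis[of j] by auto

lemmas rho_triangular = triangular_sum_degree[of "\<lambda>j. rho (basis j)", OF degree_rho_basis rho_basis_nonzero]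

text \<open>Independence of the basis images makes every coefficient zero, which also covers the
  fibre x = 0 that the chart misses.\<close>

lemma rho_eq_0_imp:
  assumes "rho f = 0" "p \<in> points surface_S"
  shows "eval3 f p = 0"
proof -
  obtain c N where f: "\<And>p. p \<in> points surface_S \<Longrightarrow> eval3 f p = (\<Sum>j<N. poly (c j) (fst p) * eval3 (basis j) p)"
    "rho f = (\<Sum>j<N. [:fls_of_poly (c j):] * rho (basis j))"
    using normal_form[of f] by blast
  have "fls_of_poly (c k) = 0" if "k < N" for k
    using rho_triangular(2)[of "\<lambda>j. fls_of_poly (c j)" N k] that f(2) assms(1) by simp
  thus ?thesis using f(1)[OF assms(2)] by simp
qed

text \<open>Among the basis elements only 1 and u have degree at most 1.\<close>

lemma rho_degree_le_1:
  assumes "degree (rho f) \<le> 1"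
  obtains a b where "\<And>p. p \<in> points surface_S \<Longrightarrow> eval3 f p = poly a (fst p) + poly b (fst p) * u_coord p"
    "degree (rho f) = 0 \<Longrightarrow> b = 0"
proof -
  obtain c N where f: "\<And>p. p \<in> points surface_S \<Longrightarrow> eval3 f p = (\<Sum>j<N. poly (c j) (fst p) * eval3 (basis j) p)"
    "rho f = (\<Sum>j<N. [:fls_of_poly (c j):] * rho (basis j))"
    using normal_form[of f] by blast
  have 0: "c k = 0" if "degree (rho f) < k" "k < N" for k
    using rho_triangular(1)[of "\<lambda>j. fls_of_poly (c j)" N k] that f(2) by simp
  \<comment> \<open>Padding with zeros gives the coefficients of 1 and u a meaning even if N <
    2.\<close>
  define d where "d j = (if j < N then c j else 0)" for j
  have "eval3 f p = poly (d 0) (fst p) + poly (d 1) (fst p) * u_coord p" if "p \<in> points surface_S" for p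
  proof -
    have "eval3 f p = (\<Sum>j<N. poly (d j) (fst p) * eval3 (basis j) p)"
      using f(1)[OF that] by (simp add: d_def)
    also have "\<dots> = (\<Sum>j<max N 2. poly (d j) (fst p) * eval3 (basis j) p)"
      by (rule sum.mono_neutral_left) (auto simp: d_def)
    also have "\<dots> = (\<Sum>j\<in>{0, 1}. poly (d j) (fst p) * eval3 (basis j) p)"
    proof (rule sum.mono_neutral_right)
      have "d j = 0" if "j \<noteq> 0" "j \<noteq> 1" for j
        using assms that 0[of j] by (simp add: d_def)
      thus "\<forall>j\<in>{..<max N 2} - {0, 1}. poly (d j) (fst p) * eval3 (basis j) p = 0"
        by simp
    qed auto
    finally show ?thesis by (simp add: basis_def)
  qed
  moreover have "d 1 = 0" if "degree (rho f) = 0"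
    using 0[of 1] that by (simp add: d_def)
  ultimately show ?thesis by (rule that[of "d 0" "d 1"])
qed

text \<open>For degree 4 k + m the top coefficient is a polynomial in x times x^(-pole). The weight
  4 i + 3 (4 k + m) is therefore a nonnegative multiple of 4 plus 0, 3, 2 or 5 for m = 0, 1, 2, 3,
  and 1 is never attained.\<close>

lemma rho_leading_exponent:
  assumes "rho f \<noteq> 0" "coeff (rho f) (degree (rho f)) $$ i \<noteq> 0"
  shows "4 * i + 3 * int (degree (rho f)) \<ge> 0" "4 * i + 3 * int (degree (rho f)) \<noteq> 1"
proof -
  obtain c N where f: "\<And>p. p \<in> points surface_S \<Longrightarrow> eval3 f p = (\<Sum>j<N. poly (c j) (fst p) * eval3 (basis j) p)"
    "rho f = (\<Sum>j<N. [:fls_of_poly (c j):] * rho (basis j))"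
    using normal_form[of f] by blast
  define d where "d = degree (rho f)"
  have 0: "c k = 0" if "d < k" "k < N" for k
    using rho_triangular(1)[of "\<lambda>j. fls_of_poly (c j)" N k] that f(2) by (simp add: d_def)
  have "coeff (rho f) d = (\<Sum>j<N. fls_of_poly (c j) * coeff (rho (basis j)) d)"
    by (simp add: f(2) coeff_sum)
  also have "\<dots> = (\<Sum>j<N. if j = d then fls_of_poly (c j) * fls_X_inv ^ pole d else 0)"
    by (intro sum.cong refl)
      (use 0 in \<open>auto simp: lead_coeff_rho_basis coeff_eq_0 degree_rho_basis not_less_iff_gr_or_eq
         elim!: linorder_neqE_nat\<close>)
  finally have "coeff (rho f) d $$ i = (if d < N then (fls_of_poly (c d) * fls_X_inv ^ pole d) $$ i else 0)"
    by simp
  hence "fls_of_poly (c d) $$ (i + pole d) \<noteq> 0"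
    using assms(2) by (simp add: d_def fls_X_inv_power_times_conv_shift split: if_splits)
  hence i: "i + pole d \<ge> 0"
    using fls_of_poly_nth_neg not_le by blast
  have "d mod 4 < 4" and d: "int d = 4 * int (d div 4) + int (d mod 4)" by presburger+
  hence m: "d mod 4 = 0 \<or> d mod 4 = 1 \<or> d mod 4 = 2 \<or> d mod 4 = 3" by linarith
  define k where "k = d div 4"
  have *: "4 * i + 3 * e \<ge> 0 \<and> 4 * i + 3 * e \<noteq> 1"
    if "i + 3 * k + b \<ge> 0" "e = 4 * k + m" "(m, b) \<in> {(0, 0), (1, 0), (2, 1), (3, 1)}" for e k b m :: int
    using that by auto presburger+
  have "4 * i + 3 * int d \<ge> 0 \<and> 4 * i + 3 * int d \<noteq> 1"
    by (rule *[of "int k" "if d mod 4 < 2 then 0 else 1" _ "int (d mod 4)"])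
      (use i d m in \<open>auto simp: pole_def simp flip: k_def\<close>)
  thus "4 * i + 3 * int (degree (rho f)) \<ge> 0" "4 * i + 3 * int (degree (rho f)) \<noteq> 1"
    by (simp_all add: d_def)
qed


section \<open>Locally nilpotent derivations of the coordinate ring kill \<open>x\<close>\<close>

definition ldx :: "laurent \<Rightarrow> laurent" where
  "ldx = map_poly fls_deriv"

lemma ldx_simps:
  "ldx (g + h) = ldx g + ldx h" "ldx (g * h) = g * ldx h + h * ldx g"
  "ldx 0 = 0" "ldx [:fls_const c:] = 0" "ldx lx = 1" "ldx lu = 0"
  using map_poly_derivation[of "fls_deriv :: complex fls \<Rightarrow> complex fls"]
  by (simp_all add: ldx_def lx_def lu_def map_poly_pCons one_pCons algebra_simps)

text \<open>The derivation P d/dx + R d/du of C((x))[u], with value P at x and R at u.\<close>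

definition Delta :: "laurent \<Rightarrow> laurent \<Rightarrow> laurent \<Rightarrow> laurent" where
  "Delta P R g = ldx g * P + pderiv g * R"

lemma Delta_simps:
  "Delta P R (g + h) = Delta P R g + Delta P R h"
  "Delta P R (g * h) = g * Delta P R h + h * Delta P R g"
  "Delta P R [:fls_const c:] = 0" "Delta P R lx = P" "Delta P R lu = R"
  by (simp_all add: Delta_def ldx_simps pderiv_add pderiv_mult algebra_simps)
    (simp_all add: lx_def lu_def pderiv_pCons)

text \<open>A derivation of the coordinate ring is determined by its values at x and u: on S, x y is
  a polynomial in u and x z one in y and u, and the factor x can be cancelled in a domain.\<close>

lemma derivation_eq_Delta:
  assumes add: "\<And>f g. D (f + g) = D f + D g"
    and mult: "\<And>f g. D (f * g) = rho f * D g + rho g * D f"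
    and const: "\<And>c. D (const3 c) = 0"
    and cong: "\<And>f g. rho f = rho g \<Longrightarrow> D f = D g"
  shows "D f = Delta (D X) (D U) (rho f)"
proof -
  let ?E = "Delta (D X) (D U)"
  have UX: "?E (rho X) = D X" "?E (rho U) = D U"
    by (simp_all add: rho_simps rho_U Delta_simps)
  have UC: "?E (rho (const3 c)) = D (const3 c)" for c
    by (simp add: rho_simps Delta_simps const)
  have Cm: "?E (rho (f * g)) = D (f * g)" if "?E (rho f) = D f" "?E (rho g) = D g" for f g
    using that by (simp add: rho_simps Delta_simps mult)
  have Ca: "?E (rho (f + g)) = D (f + g)" if "?E (rho f) = D f" "?E (rho g) = D g" for f g
    using that by (simp add: rho_simps Delta_simps add)
  have cancel: "?E (rho f) = D f" if "?E (rho (X * f)) = D (X * f)" for f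
  proof -
    have "lx * ?E (rho f) = lx * D f"
      using that UX(1) by (simp add: rho_simps Delta_simps mult)
    thus ?thesis by simp
  qed
  have Y: "?E (rho Y) = D Y"
  proof (rule cancel)
    have eq: "rho (X * Y) = rho ((U + const3 1) * (U + const3 4))"
      by (rule rho_cong) (simp add: mem_S_iff)
    have "?E (rho ((U + const3 1) * (U + const3 4))) = D ((U + const3 1) * (U + const3 4))"
      by (intro Cm Ca UX UC)
    thus "?E (rho (X * Y)) = D (X * Y)"
      using cong[OF eq] eq by simp
  qed
  have Z: "?E (rho Z) = D Z"
  proof (rule cancel)
    have eq: "rho (X * Z) = rho (Y * Y + U)"
      by (rule rho_cong) (simp add: u_coord_def power2_eq_square)
    have "?E (rho (Y * Y + U)) = D (Y * Y + U)"
      by (intro Cm Ca UX Y)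
    thus "?E (rho (X * Z)) = D (X * Z)"
      using cong[OF eq] eq by simp
  qed
  have "?E (rho f) = D f"
    by (induction f rule: poly3_induct) (intro UC UX Y Z Ca Cm; assumption)+
  thus ?thesis by simp
qed

text \<open>
  Leading terms with respect to the degree in \<open>u\<close> and then the order in \<open>x\<close>; the exponents are
  only bounds, since \<open>c = 0\<close> is allowed.
\<close>

definition leads :: "laurent \<Rightarrow> int \<Rightarrow> nat \<Rightarrow> complex \<Rightarrow> bool" where
  "leads g i j c \<longleftrightarrow> degree g \<le> j \<and> (\<forall>l<i. coeff g j $$ l = 0) \<and> coeff g j $$ i = c"

lemma fls_mult_lowest:
  fixes f g :: "complex fls"
  assumes "\<forall>l<a. f $$ l = 0" "\<forall>l<b. g $$ l = 0"
  shows "\<forall>l<a + b. (f * g) $$ l = 0" "(f * g) $$ (a + b) = f $$ a * g $$ b"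
proof -
  have "(\<forall>l<a + b. (f * g) $$ l = 0) \<and> (f * g) $$ (a + b) = f $$ a * g $$ b"
  proof (cases "f = 0 \<or> g = 0")
    case False
    have a: "a \<le> fls_subdegree f" and b: "b \<le> fls_subdegree g"
      using False assms by (auto intro: fls_subdegree_geI)
    show ?thesis
    proof (cases "a = fls_subdegree f \<and> b = fls_subdegree g")
      case True
      thus ?thesis by (auto intro: fls_times_nth_eq0)
    next
      case ne: False
      hence "a + b < fls_subdegree f + fls_subdegree g" using a b by auto
      moreover have "f $$ a = 0 \<or> g $$ b = 0"
        using ne a b by (auto simp: le_less)
      ultimately show ?thesis by (auto intro: fls_times_nth_eq0)
    qed
  qed auto
  thus "\<forall>l<a + b. (f * g) $$ l = 0" "(f * g) $$ (a + b) = f $$ a * g $$ b"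
    by blast+
qed

lemma coeff_mult_degree_bound:
  fixes p q :: "'a::comm_ring_1 poly"
  assumes "degree p \<le> m" "degree q \<le> n"
  shows "coeff (p * q) (m + n) = coeff p m * coeff q n"
proof -
  have "coeff (p * q) (m + n) = (\<Sum>i\<le>m + n. coeff p i * coeff q (m + n - i))"
    by (rule coeff_mult)
  also have "\<dots> = (\<Sum>i\<in>{m}. coeff p i * coeff q (m + n - i))"
  proof (rule sum.mono_neutral_right)
    have "coeff p i * coeff q (m + n - i) = 0" if "i \<noteq> m" "i \<le> m + n" for i
    proof (cases "m < i")
      case True
      thus ?thesis using assms by (simp add: coeff_eq_0)
    next
      case False
      hence "degree q < m + n - i" using that assms by linarith
      thus ?thesis by (simp add: coeff_eq_0)
    qed
    thus "\<forall>i\<in>{..m + n} - {m}. coeff p i * coeff q (m + n - i) = 0" by auto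
  qed auto
  finally show ?thesis by simp
qed

lemma leads_mult:
  assumes "leads g i j c" "leads h i' j' c'"
  shows "leads (g * h) (i + i') (j + j') (c * c')"
proof -
  have "coeff (g * h) (j + j') = coeff g j * coeff h j'"
    using assms by (intro coeff_mult_degree_bound) (auto simp: leads_def)
  moreover have "degree (g * h) \<le> j + j'"
    using degree_mult_le[of g h] assms by (simp add: leads_def)
  ultimately show ?thesis
    using fls_mult_lowest[of i "coeff g j" i' "coeff h j'"] assms by (simp add: leads_def)
qed

lemma leads_add: "leads g i j c \<Longrightarrow> leads h i j c' \<Longrightarrow> leads (g + h) i j (c + c')"
  by (auto simp: leads_def intro: degree_add_le)

lemma leads_0: "leads 0 i j 0"
  by (simp add: leads_def)

lemma leads_ldx: "leads g i j c \<Longrightarrow> leads (ldx g) (i - 1) j (of_int i * c)"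
  unfolding leads_def ldx_def
  by (auto simp: coeff_map_poly intro: order_trans[OF map_poly_degree_leq])

lemma leads_pderiv: "leads g i (Suc j) c \<Longrightarrow> leads (pderiv g) i j (of_nat (Suc j) * c)"
proof -
  assume "leads g i (Suc j) c"
  moreover have nth: "(of_nat n * f) $$ l = of_nat n * f $$ l" for n l and f :: "complex fls"
    by (induction n) (simp_all add: distrib_right)
  have "coeff (pderiv g) j $$ l = of_nat (Suc j) * (coeff g (Suc j) $$ l)" for l
    unfolding coeff_pderiv by (rule nth)
  ultimately show ?thesis
    by (auto simp: leads_def degree_pderiv)
qed

text \<open>Since d/dx lowers i by one and d/du lowers j by one, the offsets in the bounds on P and
  R make both summands shift the exponent by the same (a, d).\<close>

lemma leads_Delta:
  assumes P: "leads P (a + 1) d \<alpha>" and R: "leads R a (d + 1) \<beta>" and g: "leads g i j c"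
  shows "leads (Delta P R g) (i + a) (j + d) (c * (of_int i * \<alpha> + of_nat j * \<beta>))"
proof -
  have 1: "leads (ldx g * P) (i + a) (j + d) (of_int i * c * \<alpha>)"
    using leads_mult[OF leads_ldx[OF g] P] by simp
  have 2: "leads (pderiv g * R) (i + a) (j + d) (of_nat j * c * \<beta>)"
  proof (cases j)
    case 0
    hence "pderiv g = 0" using g by (simp add: leads_def pderiv_eq_0_iff)
    thus ?thesis using 0 by (simp add: leads_0)
  next
    case (Suc j')
    have "leads (pderiv g) i j' (of_nat j * c)"
      using leads_pderiv[of g i j' c] g Suc by simp
    from leads_mult[OF this R] show ?thesis by (simp add: Suc)
  qed
  show ?thesis
    using leads_add[OF 1 2] by (simp add: Delta_def algebra_simps)
qed

lemma leads_Delta_iter: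
  assumes P: "leads P (a + 1) d \<alpha>" and R: "leads R a (d + 1) \<beta>" and g: "leads g i j c"
  shows "leads ((Delta P R ^^ k) g) (i + int k * a) (j + k * d)
    (c * (\<Prod>l<k. of_int (i + int l * a) * \<alpha> + of_nat (j + l * d) * \<beta>))"
proof (induction k)
  case (Suc k)
  show ?case
    using leads_Delta[OF P R Suc] by (simp add: algebra_simps)
qed (use g in simp)

text \<open>Taking d as large as the degrees in u require and then a as small as the orders in x
  allow keeps one of the two leading coefficients nonzero.\<close>

lemma leads_exists:
  assumes "P \<noteq> 0"
  obtains a d \<alpha> \<beta> where "leads P (a + 1) d \<alpha>" "leads R a (d + 1) \<beta>" "\<alpha> \<noteq> 0 \<or> \<beta> \<noteq> 0"
proof -
  define d where "d = max (degree P) (degree R - 1)"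
  define f g where "f = coeff P d" and "g = coeff R (d + 1)"
  have nz: "f \<noteq> 0 \<or> g \<noteq> 0"
  proof (cases "d = degree P")
    case True
    thus ?thesis using assms by (simp add: f_def)
  next
    case False
    hence "degree R = d + 1" unfolding d_def by linarith
    hence "g = lead_coeff R" "R \<noteq> 0" by (auto simp: g_def)
    thus ?thesis by simp
  qed
  \<comment> \<open>The zero series has subdegree 0 by convention, which would spoil the minimum; a
    vanishing f or g is therefore set apart.\<close>
  define a where "a = (if f = 0 then fls_subdegree g else if g = 0 then fls_subdegree f - 1
    else min (fls_subdegree g) (fls_subdegree f - 1))"
  have "leads P (a + 1) d (f $$ (a + 1))"
    by (auto simp: leads_def d_def simp flip: f_def) (auto simp: a_def d_def f_def split: if_splits)
  moreover have "leads R a (d + 1) (g $$ a)"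
    by (auto simp: leads_def a_def d_def g_def split: if_splits)
  moreover have "f $$ (a + 1) \<noteq> 0 \<or> g $$ a \<noteq> 0"
    using nz by (auto simp: a_def min_def)
  ultimately show ?thesis using that by blast
qed

lemma leads_coordinates:
  "leads (rho X) 1 0 1" "leads (rho U) 0 1 1" "leads (rho Y) (-1) 2 1" "leads (rho Z) (-3) 4 1"
proof -
  have inv: "leads lx_inv (-1) 0 1"
    by (simp add: leads_def lx_inv_def)
  show U: "leads (rho U) 0 1 1"
    by (simp add: leads_def rho_U lu_def)
  show "leads (rho X) 1 0 1"
    by (simp add: leads_def rho_simps lx_def)
  have c: "leads (lu + 1) 0 1 1" "leads (lu + 4) 0 1 1"
    by (simp_all add: leads_def lu_def one_pCons numeral_poly)
  have ly: "leads ly (-1) 2 1"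
    using leads_mult[OF inv leads_mult[OF c]] by (simp add: ly_def numeral_2_eq_2)
  thus "leads (rho Y) (-1) 2 1"
    by (simp add: rho_simps)
  \<comment> \<open>Read at the exponent (-2, 4) of y^2, the summand u contributes the coefficient
    0.\<close>
  have "leads lu (-2) 4 0"
    by (simp add: leads_def lu_def coeff_eq_0)
  from leads_mult[OF inv leads_add[OF leads_mult[OF ly ly, simplified] this]]
  have "leads lz (-3) 4 1"
    by (simp add: lz_def power2_eq_square)
  thus "leads (rho Z) (-3) 4 1"
    by (simp add: rho_simps)
qed

text \<open>
  Comparing leading terms reduces the claim to the semigroup of exponents: the leading form of a
  derivation moving \<open>x\<close> would have to lower the weight \<open>4 i + 3 j\<close> of the leading exponent
  \<open>(i, j)\<close> by one, but \<open>y\<close> has weight \<open>2\<close> and no element has weight \<open>1\<close>.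
\<close>

lemma locally_nilpotent_kills_x:
  assumes closed: "\<And>f. \<exists>g. Delta P R (rho f) = rho g"
    and nilpotent: "\<And>f. \<exists>k. (Delta P R ^^ k) (rho f) = 0"
  shows "P = 0"
proof (rule ccontr)
  assume "P \<noteq> 0"
  then obtain a d \<alpha> \<beta> where P: "leads P (a + 1) d \<alpha>" and R: "leads R a (d + 1) \<beta>"
    and nz: "\<alpha> \<noteq> 0 \<or> \<beta> \<noteq> 0"
    by (rule leads_exists)
  define e where "e = of_int a * \<alpha> + of_nat d * \<beta>"
  \<comment> \<open>Once an iterate vanishes, so does one factor of its leading coefficient; these
    factors form an arithmetic progression with difference e.\<close>
  have ex: "\<exists>l::nat. of_int i * \<alpha> + of_nat j * \<beta> + of_nat l * e = 0" if f: "leads (rho f) i j 1" for f i j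
  proof -
    obtain k where "(Delta P R ^^ k) (rho f) = 0" using nilpotent by blast
    hence "(\<Prod>l<k. of_int (i + int l * a) * \<alpha> + of_nat (j + l * d) * \<beta>) = 0"
      using leads_Delta_iter[OF P R f, of k] by (simp add: leads_def)
    then obtain l where "of_int (i + int l * a) * \<alpha> + of_nat (j + l * d) * \<beta> = 0"
      by (auto simp: prod_zero_iff)
    thus ?thesis by (intro exI[of _ l]) (simp add: e_def algebra_simps)
  qed
  \<comment> \<open>For x and u this makes \<alpha> and \<beta> integer multiples of e, so the rest
    is arithmetic with the weight i p + j q.\<close>
  obtain p where "of_int 1 * \<alpha> + of_nat 0 * \<beta> + of_nat p * e = 0"
    using ex[OF leads_coordinates(1)] by blast
  hence p: "\<alpha> = - of_nat p * e" by (simp add: eq_neg_iff_add_eq_0)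
  obtain q where "of_int 0 * \<alpha> + of_nat 1 * \<beta> + of_nat q * e = 0"
    using ex[OF leads_coordinates(2)] by blast
  hence q: "\<beta> = - of_nat q * e" by (simp add: eq_neg_iff_add_eq_0)
  have e: "e \<noteq> 0" using nz p q by auto
  have weight: "of_int i * \<alpha> + of_nat j * \<beta> = - of_int (i * int p + int j * int q) * e" for i j
    by (simp add: p q algebra_simps)
  \<comment> \<open>The shift (a, d) itself has the value e, so its weight is -1.\<close>
  have "e = - of_int (a * int p + int d * int q) * e"
    using weight[of a d] unfolding e_def[symmetric] .
  hence "of_int (a * int p + int d * int q) * e = of_int (-1) * e"
    by (metis minus_minus mult_minus_left of_int_minus of_int_1 mult_1)
  hence 1: "a * int p + int d * int q = -1"
    using e by (metis mult_right_cancel of_int_eq_iff)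
  \<comment> \<open>The weight of a leading exponent is the natural number l supplied by
    \<open>ex\<close>.\<close>
  have nat: "i * int p + int j * int q \<ge> 0" if f: "leads (rho f) i j 1" for f i j
  proof -
    obtain l where "of_int i * \<alpha> + of_nat j * \<beta> + of_nat l * e = 0"
      using ex[OF f] by blast
    hence "- of_int (i * int p + int j * int q) * e + of_int (int l) * e = 0"
      unfolding weight by simp
    moreover have "v * e = w * e" if "- v * e + w * e = 0" for v w
      using that by algebra
    ultimately have "of_int (i * int p + int j * int q) * e = of_int (int l) * e"
      by blast
    hence "i * int p + int j * int q = int l"
      using e by (metis mult_right_cancel of_int_eq_iff)
    thus ?thesis by simp
  qed
  have exponent: "4 * (i + a) + 3 * int (j + d) \<ge> 0 \<and> 4 * (i + a) + 3 * int (j + d) \<noteq> 1"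
    if f: "leads (rho f) i j 1" and "i * int p + int j * int q \<noteq> 0" for f i j
  proof -
    obtain g where g: "Delta P R (rho f) = rho g" using closed by blast
    have "leads (rho g) (i + a) (j + d) (of_int i * \<alpha> + of_nat j * \<beta>)"
      using leads_Delta[OF P R f] by (simp add: g)
    moreover have "of_int i * \<alpha> + of_nat j * \<beta> \<noteq> 0"
      unfolding weight using that(2) e by (metis mult_eq_0_iff neg_equal_0_iff_equal of_int_eq_0_iff)
    ultimately have deg: "degree (rho g) \<le> j + d" and c: "coeff (rho g) (j + d) $$ (i + a) \<noteq> 0"
      by (auto simp: leads_def)
    hence "coeff (rho g) (j + d) \<noteq> 0" by auto
    hence "degree (rho g) = j + d" "rho g \<noteq> 0"
      using deg le_degree[of "rho g" "j + d"] by auto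
    with rho_leading_exponent[of g "i + a"] c show ?thesis by auto
  qed
  \<comment> \<open>The exponent (-3, 4) of z gives 4 q >= 3 p; with a p + d q = -1 this yields p (4
    a + 3 d) <= -4.\<close>
  have s: "4 * int q \<ge> 3 * int p"
    using nat[OF leads_coordinates(4)] by simp
  have "int p * (4 * a + 3 * int d) \<le> 4 * (a * int p + int d * int q)"
    using mult_left_mono[OF s, of "int d"] by (simp add: algebra_simps)
  hence "int p * (4 * a + 3 * int d) < 0"
    using 1 by simp
  hence neg: "4 * a + 3 * int d < 0"
    by (simp add: mult_less_0_iff)
  \<comment> \<open>Otherwise the image of z would have the leading exponent (a - 3, d + 4), whose
    value 4 a + 3 d is negative.\<close>
  hence "4 * int q = 3 * int p"
    using exponent[OF leads_coordinates(4)] by auto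
  hence t: "int p = 4 * t" "int q = 3 * t" if "t = int p - int q" for t
    using that by simp_all
  define t where "t = int p - int q"
  note t = t[OF t_def]
  define K where "K = 4 * a + 3 * int d"
  have "t * K = -1"
    using 1 by (simp add: t K_def algebra_simps)
  have "t \<ge> 0" using t(1) by simp
  with \<open>t * K = -1\<close> have "t = 1" "K = -1"
    by (auto simp: zmult_eq_neg1_iff)
  \<comment> \<open>The exponent (-1, 2) of y has value 2 under 4 i + 3 j, so its image would have
    the excluded value 1.\<close>
  with exponent[OF leads_coordinates(3)] t show False
    by (simp add: K_def)
qed


section \<open>\<open>S\<close> is not isomorphic to a surface of type \<open>S_{Q,n}\<close>\<close>

lemma poly_finite_values_constant:
  fixes r s :: "complex poly"
  assumes "r \<noteq> 0" "\<And>t. poly r (poly s t) = 0"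
  shows "poly s t = poly s t'"
proof -
  have "pcompose r s = 0"
    using assms(2) by (simp add: poly_pcompose flip: poly_all_0_iff_0)
  hence "degree s = 0"
    using assms(1) pcompose_eq_0 by blast
  then obtain c where "s = [:c:]" by (rule degree_eq_zeroE)
  thus ?thesis by simp
qed

lemma eval3_line: "eval3 F (x, y, t) = poly (map_poly (\<lambda>b. eval2 b (x, y)) F) t"
proof (induction F)
  case (pCons b F)
  have "pCons b F = [:b:] + Z * F" by (simp add: Z_def)
  hence "eval3 (pCons b F) (x, y, t) = eval2 b (x, y) + t * eval3 F (x, y, t)"
    by (simp del: add_pCons)
  thus ?case by (simp add: map_poly_pCons pCons)
qed (use is_ring_homD(1)[OF is_ring_hom_eval3] in simp)

lemma eval3_line_constant:
  assumes "r \<noteq> 0" "\<And>t. poly r (eval3 F (x, y, t)) = 0"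
  shows "eval3 F (x, y, t) = eval3 F (x, y, t')"
  using poly_finite_values_constant assms unfolding eval3_line by blast

lemma eval2_has_field_derivative:
  "((\<lambda>t. eval2 Q (x, t)) has_field_derivative eval2 (pderiv Q) (x, y)) (at y)"
  using eval3_has_field_derivative[where b = "\<lambda>t. t" and c = "\<lambda>t. 0" and f = "[:Q:]" and x = x
      and t = y, OF DERIV_ident DERIV_const] by simp

text \<open>The components are polynomial representatives of the pulled back coordinate
  functions.\<close>

lemma morphism_surface_polynomial:
  assumes "morphism (surface F) (surface G) \<phi>"
  shows "\<exists>\<Phi>. \<forall>p \<in> points (surface F). \<phi> p = eval_triple \<Phi> p"
proof -
  have *: "\<exists>f. \<forall>p \<in> points (surface F). eval3 W (\<phi> p) = eval3 f p" for W
  proof -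
    let ?g = "restrict (eval3 W) (points (surface G))"
    have "?g \<in> regular (surface G)"
      by (auto simp: surface_def Let_def)
    hence "restrict (?g \<circ> \<phi>) (points (surface F)) \<in> regular (surface F)"
      using assms by (simp add: morphism_def)
    then obtain f where f: "restrict (?g \<circ> \<phi>) (points (surface F)) = restrict (eval3 f) (points (surface F))"
      by (auto simp: surface_def Let_def)
    have "eval3 W (\<phi> p) = eval3 f p" if "p \<in> points (surface F)" for p
    proof -
      have "\<phi> p \<in> points (surface G)" using assms that by (auto simp: morphism_def)
      thus ?thesis using fun_cong[OF f, of p] that by simp
    qed
    thus ?thesis by blast
  qed
  obtain f g h where "\<forall>p \<in> points (surface F). eval3 X (\<phi> p) = eval3 f p"
      "\<forall>p \<in> points (surface F). eval3 Y (\<phi> p) = eval3 g p"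
      "\<forall>p \<in> points (surface F). eval3 Z (\<phi> p) = eval3 h p"
    using * by meson
  hence "\<forall>p \<in> points (surface F). \<phi> p = eval_triple (f, g, h) p"
    by (simp add: eval_triple_def prod_eq_iff)
  thus ?thesis by blast
qed

text \<open>The polynomial triples are mutually inverse only on the surfaces, so identities between
  their compositions are stated after \<open>rho\<close> or at points.\<close>

locale isomorphism_S_SQn =
  fixes Q :: poly2 and n :: nat and \<Phi> \<Psi> :: "poly3 \<times> poly3 \<times> poly3"
  assumes n: "n \<ge> 1"
    and \<Phi>: "\<And>p. p \<in> points surface_S \<Longrightarrow> eval_triple \<Phi> p \<in> points (surface_S_Qn Q n)"
    and \<Psi>: "\<And>q. q \<in> points (surface_S_Qn Q n) \<Longrightarrow> eval_triple \<Psi> q \<in> points surface_S"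
    and \<Psi>\<Phi>: "\<And>p. p \<in> points surface_S \<Longrightarrow> eval_triple \<Psi> (eval_triple \<Phi> p) = p"
    and \<Phi>\<Psi>: "\<And>q. q \<in> points (surface_S_Qn Q n) \<Longrightarrow> eval_triple \<Phi> (eval_triple \<Psi> q) = q"
begin

text \<open>It annihilates x^n z - Q and is therefore tangent to the surface.\<close>

definition \<delta> :: "poly3 \<Rightarrow> poly3" where
  "\<delta> f = X ^ n * d_dy f + [:pderiv Q:] * d_dz f"

lemma derivation_\<delta>: "derivation \<delta>"
  unfolding \<delta>_def by (rule derivation_yz)

lemmas \<delta>_simps = derivationD[OF derivation_\<delta>]

lemma \<delta>_diff: "\<delta> (f - g) = \<delta> f - \<delta> g"
  using \<delta>_simps(1)[of "f - g" g] by (simp add: algebra_simps)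

lemma \<delta>_variables: "\<delta> X = 0" "\<delta> Y = X ^ n" "\<delta> Z = [:pderiv Q:]"
  by (simp_all add: \<delta>_def)

lemma \<delta>_power_X: "\<delta> (X ^ k) = 0"
  by (induction k) (use \<delta>_simps(3)[of 1] in \<open>simp_all add: \<delta>_simps \<delta>_variables const3_simps\<close>)

text \<open>The derivation is triangular: it kills C[x], kills y in two steps, and maps z into
  C[x, y].\<close>

lemma locally_nilpotent_\<delta>: "\<exists>k. (\<delta> ^^ k) f = 0"
proof -
  have Y: "(\<delta> ^^ 2) Y = 0"
    by (simp add: \<delta>_variables \<delta>_power_X numeral_2_eq_2)
  have "\<exists>k. (\<delta> ^^ k) [:r:] = 0" for r
  proof (induction r)
    case (pCons a r)
    then obtain k where "(\<delta> ^^ k) [:r:] = 0" by blast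
    hence "(\<delta> ^^ (2 + k)) (Y * [:r:]) = 0"
      using derivation_nilpotent_mult[OF derivation_\<delta> Y] by blast
    moreover have "(\<delta> ^^ (2 + k)) [:[:a:]:] = 0"
    proof (rule derivation_nilpotent_mono[OF derivation_\<delta>, of 1])
      show "(\<delta> ^^ 1) [:[:a:]:] = 0" by (simp add: \<delta>_def)
    qed simp
    moreover have "[:pCons a r:] = [:[:a:]:] + Y * [:r:]" by (simp add: Y_def)
    ultimately have "(\<delta> ^^ (2 + k)) [:pCons a r:] = 0"
      by (simp only: derivation_iter(1)[OF derivation_\<delta>]) simp
    thus ?case by blast
  qed (use \<delta>_simps(4) in \<open>auto intro: exI[of _ 0]\<close>)
  then obtain k where "(\<delta> ^^ k) [:pderiv Q:] = 0" by blast
  hence "(\<delta> ^^ Suc k) Z = 0"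
    by (simp add: funpow_Suc_right \<delta>_variables del: funpow.simps)
  hence "locally_nilpotent_derivation \<delta>"
    using Y \<delta>_variables(1) by (intro locally_nilpotentI[OF derivation_\<delta>, of 1 2 "Suc k"]) simp_all
  thus ?thesis by (simp add: locally_nilpotent_derivation_def)
qed

lemma comp3_simps:
  "comp3 (f + g) \<Theta> = comp3 f \<Theta> + comp3 g \<Theta>" "comp3 (f - g) \<Theta> = comp3 f \<Theta> - comp3 g \<Theta>"
  "comp3 (f * g) \<Theta> = comp3 f \<Theta> * comp3 g \<Theta>" "comp3 (f ^ k) \<Theta> = comp3 f \<Theta> ^ k"
  "comp3 0 \<Theta> = 0" "comp3 (const3 c) \<Theta> = const3 c"
  using is_ring_homD[OF is_ring_hom_subst3[OF is_ring_hom_const3]]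
    is_ring_hom_diff[OF is_ring_hom_subst3[OF is_ring_hom_const3]]
    is_ring_hom_power[OF is_ring_hom_subst3[OF is_ring_hom_const3]]
    subst3_variables[OF is_ring_hom_const3]
  by simp_all

lemma graph_in_SQn: "x \<noteq> 0 \<Longrightarrow> (x, y, eval2 Q (x, y) / x ^ n) \<in> points (surface_S_Qn Q n)"
  by (simp add: points_surface_S_Qn)

text \<open>For nonzero x the surface is the graph of z = Q / x^n, along which
  \<open>\<delta>\<close> is x^n times the derivative in y. Differentiating the zero function avoids
  computing the ideal of the surface.\<close>

lemma \<delta>_vanishes_generically:
  assumes "\<And>q. q \<in> points (surface_S_Qn Q n) \<Longrightarrow> eval3 g q = 0"
    and "q \<in> points (surface_S_Qn Q n)" "fst q \<noteq> 0"
  shows "eval3 (\<delta> g) q = 0"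
proof -
  obtain x y z where q: "q = (x, y, z)" by (cases q)
  have x: "x \<noteq> 0" and z: "z = eval2 Q (x, y) / x ^ n"
    using assms(2,3) by (auto simp: q points_surface_S_Qn field_simps)
  let ?h = "\<lambda>t. eval3 g (x, t, eval2 Q (x, t) / x ^ n)"
  have "(?h has_field_derivative
      eval3 (d_dy g) (x, y, z) * 1 + eval3 (d_dz g) (x, y, z) * (eval2 (pderiv Q) (x, y) / x ^ n)) (at y)"
    unfolding z
    by (rule eval3_has_field_derivative[OF DERIV_ident DERIV_cdivide[OF eval2_has_field_derivative]])
  moreover have "?h = (\<lambda>t. 0)"
    using assms(1)[OF graph_in_SQn[OF x]] by (rule ext)
  hence "(?h has_field_derivative 0) (at y)"
    by simp
  ultimately have "eval3 (d_dy g) (x, y, z) * 1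
      + eval3 (d_dz g) (x, y, z) * (eval2 (pderiv Q) (x, y) / x ^ n) = 0"
    by (rule DERIV_unique)
  hence "eval3 (d_dy g) q + eval3 (d_dz g) q * (eval2 (pderiv Q) (x, y) / x ^ n) = 0"
    by (simp add: q)
  moreover have "eval3 (\<delta> g) q
      = x ^ n * (eval3 (d_dy g) q + eval3 (d_dz g) q * (eval2 (pderiv Q) (x, y) / x ^ n))"
    using x by (simp add: \<delta>_def q distrib_left)
  ultimately show ?thesis by simp
qed

lemma rho_x'_nonzero: "rho (comp3 X \<Phi>) \<noteq> 0"
proof
  assume 0: "rho (comp3 X \<Phi>) = 0"
  define q where "q = (1 :: complex, 0 :: complex, eval2 Q (1, 0))"
  have q: "q \<in> points (surface_S_Qn Q n)"
    using graph_in_SQn[of 1 0] by (simp add: q_def)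
  have "eval3 (comp3 X \<Phi>) (eval_triple \<Psi> q) = 0"
    using rho_eq_0_imp[OF 0 \<Psi>[OF q]] .
  hence "fst q = 0" unfolding eval3_comp3 \<Phi>\<Psi>[OF q] by simp
  thus False by (simp add: q_def)
qed

text \<open>Multiplying by x' extends the vanishing to the fibre x' = 0, and x' is then cancelled in
  the Laurent ring. So \<open>\<delta>\<close> descends to functions on the surface.\<close>

lemma \<delta>_cong:
  assumes "\<And>q. q \<in> points (surface_S_Qn Q n) \<Longrightarrow> eval3 f q = eval3 g q"
  shows "rho (comp3 (\<delta> f) \<Phi>) = rho (comp3 (\<delta> g) \<Phi>)"
proof -
  let ?h = "f - g"
  have "eval3 (comp3 (X * \<delta> ?h) \<Phi>) p = 0" if "p \<in> points surface_S" for p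
    using \<delta>_vanishes_generically[of ?h "eval_triple \<Phi> p"] assms \<Phi>[OF that] unfolding eval3_comp3 by auto
  hence "rho (comp3 X \<Phi>) * rho (comp3 (\<delta> ?h) \<Phi>) = 0"
    using rho_eq_0[of "comp3 (X * \<delta> ?h) \<Phi>"] by (simp only: comp3_simps rho_simps)
  hence "rho (comp3 (\<delta> ?h) \<Phi>) = 0"
    using rho_x'_nonzero by simp
  thus ?thesis by (simp only: \<delta>_diff comp3_simps rho_simps) simp
qed

text \<open>The derivation of the target surface transported to S, with values in C((x))[u].\<close>

definition D :: "poly3 \<Rightarrow> laurent" where
  "D f = rho (comp3 (\<delta> (comp3 f \<Psi>)) \<Phi>)"

lemma rho_comp3_comp3: "rho (comp3 (comp3 f \<Psi>) \<Phi>) = rho f"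
  by (rule rho_cong) (simp add: eval3_comp3 \<Psi>\<Phi>)

lemma D_eq_Delta: "D f = Delta (D X) (D U) (rho f)"
proof (rule derivation_eq_Delta)
  show "D (f + g) = D f + D g" for f g
    by (simp only: D_def comp3_simps \<delta>_simps rho_simps)
  show "D (f * g) = rho f * D g + rho g * D f" for f g
    by (simp only: D_def comp3_simps \<delta>_simps rho_simps rho_comp3_comp3)
  show "D (const3 c) = 0" for c
    by (simp only: D_def comp3_simps \<delta>_simps rho_simps)
  show "D f = D g" if "rho f = rho g" for f g
    unfolding D_def
  proof (rule \<delta>_cong)
    have "rho (f - g) = 0" using that by (simp add: rho_simps)
    hence "eval3 (f - g) p = 0" if "p \<in> points surface_S" for p
      using that by (rule rho_eq_0_imp)
    thus "eval3 (comp3 f \<Psi>) q = eval3 (comp3 g \<Psi>) q" if "q \<in> points (surface_S_Qn Q n)" for q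
      using \<Psi>[OF that] by (simp add: eval3_comp3)
  qed
qed

lemma Delta_comp3: "Delta (D X) (D U) (rho (comp3 h \<Phi>)) = rho (comp3 (\<delta> h) \<Phi>)"
  unfolding D_eq_Delta[symmetric] unfolding D_def
  by (rule \<delta>_cong) (simp add: eval3_comp3 \<Phi>\<Psi>)

lemma Delta_iter: "(Delta (D X) (D U) ^^ k) (rho f) = rho (comp3 ((\<delta> ^^ k) (comp3 f \<Psi>)) \<Phi>)"
  by (induction k) (simp_all add: rho_comp3_comp3 Delta_comp3)

lemma D_X: "D X = 0"
proof (rule locally_nilpotent_kills_x)
  show "\<exists>g. Delta (D X) (D U) (rho f) = rho g" for f
    using D_eq_Delta[of f] unfolding D_def by metis
  show "\<exists>k. (Delta (D X) (D U) ^^ k) (rho f) = 0" for f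
    using locally_nilpotent_\<delta>[of "comp3 f \<Psi>"] Delta_iter[of _ f] comp3_simps(5) rho_simps(1) by metis
qed

text \<open>As \<open>D X = 0\<close>, the transported derivation is a multiple of d/du. It kills
  x', which is thus free of u, and sends y' to x'^n, so both y'_u and the multiplier have degree 0
  in u.\<close>

lemma x'_y'_on_S:
  obtains p a b where
    "\<And>s. s \<in> points surface_S \<Longrightarrow> fst (eval_triple \<Phi> s) = poly p (fst s)" "p \<noteq> 0"
    "\<And>s. s \<in> points surface_S \<Longrightarrow> fst (snd (eval_triple \<Phi> s)) = poly a (fst s) + poly b (fst s) * u_coord s"
proof -
  define x' y' where "x' = rho (comp3 X \<Phi>)" and "y' = rho (comp3 Y \<Phi>)"
  have "Delta (D X) (D U) x' = rho (comp3 0 \<Phi>)"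
    unfolding x'_def Delta_comp3 \<delta>_variables ..
  hence 1: "pderiv x' * D U = 0"
    by (simp only: Delta_def D_X comp3_simps rho_simps) simp
  have "Delta (D X) (D U) y' = rho (comp3 (X ^ n) \<Phi>)"
    unfolding y'_def Delta_comp3 \<delta>_variables ..
  hence 2: "pderiv y' * D U = x' ^ n"
    by (simp only: Delta_def D_X comp3_simps rho_simps x'_def) simp
  have x'0: "x' \<noteq> 0" using rho_x'_nonzero by (simp add: x'_def)
  hence "pderiv y' * D U \<noteq> 0" using 2 by simp
  hence nz: "pderiv y' \<noteq> 0" "D U \<noteq> 0" by auto
  hence "pderiv x' = 0" using 1 by simp
  hence dx: "degree x' = 0" by (simp add: pderiv_eq_0_iff)
  hence "degree (x' ^ n) = 0" using x'0 by (simp add: degree_power_eq)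
  hence "degree (pderiv y') = 0"
    unfolding 2[symmetric] using nz by (simp add: degree_mult_eq)
  hence dy: "degree y' \<le> 1" by (simp add: degree_pderiv)
  obtain p b0 where p: "\<And>s. s \<in> points surface_S \<Longrightarrow>
      eval3 (comp3 X \<Phi>) s = poly p (fst s) + poly b0 (fst s) * u_coord s" "b0 = 0"
    using rho_degree_le_1[of "comp3 X \<Phi>"] dx unfolding x'_def by (metis zero_le)
  obtain a b where ab: "\<And>s. s \<in> points surface_S \<Longrightarrow>
      eval3 (comp3 Y \<Phi>) s = poly a (fst s) + poly b (fst s) * u_coord s"
    using rho_degree_le_1[of "comp3 Y \<Phi>"] dy unfolding y'_def by metis
  have "p \<noteq> 0"
  proof
    assume "p = 0"
    hence "rho (comp3 X \<Phi>) = 0"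
      using p by (intro rho_eq_0) simp
    thus False using rho_x'_nonzero by contradiction
  qed
  thus ?thesis
    using p ab by (intro that[of p a b]) (simp_all add: eval3_comp3)
qed

lemma contradiction: False
proof -
  obtain p a b where x': "\<And>s. s \<in> points surface_S \<Longrightarrow> fst (eval_triple \<Phi> s) = poly p (fst s)"
    and p0: "p \<noteq> 0"
    and y': "\<And>s. s \<in> points surface_S \<Longrightarrow>
      fst (snd (eval_triple \<Phi> s)) = poly a (fst s) + poly b (fst s) * u_coord s"
    using x'_y'_on_S by metis
  \<comment> \<open>The common values of x' and y' at the two points below, at which x = 0 and u =
    -1.\<close>
  define c w where "c = poly p 0" and "w = poly a 0 - poly b 0"
  define s1 s2 :: point3 where "s1 = (0, 1, 0)" and "s2 = (0, -1, 0)"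
  have S: "s1 \<in> points surface_S" "s2 \<in> points surface_S"
    by (simp_all add: s1_def s2_def mem_S_iff u_coord_def)
  define z1 z2 where "z1 = snd (snd (eval_triple \<Phi> s1))" and "z2 = snd (snd (eval_triple \<Phi> s2))"
  have e: "eval_triple \<Phi> s1 = (c, w, z1)" "eval_triple \<Phi> s2 = (c, w, z2)"
    using x'[OF S(1)] x'[OF S(2)] y'[OF S(1)] y'[OF S(2)]
    by (simp_all add: prod_eq_iff z1_def z2_def c_def w_def s1_def s2_def u_coord_def)
  have m: "(c, w, z1) \<in> points (surface_S_Qn Q n)" "(c, w, z2) \<in> points (surface_S_Qn Q n)"
    using \<Phi>[OF S(1)] \<Phi>[OF S(2)] e by simp_all
  have inv: "eval_triple \<Psi> (c, w, z1) = s1" "eval_triple \<Psi> (c, w, z2) = s2"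
    using \<Psi>\<Phi>[OF S(1)] \<Psi>\<Phi>[OF S(2)] e by simp_all
  show False
  proof (cases "c = 0")
    case False
    have "c ^ n * z1 = c ^ n * z2" using m by (simp add: points_surface_S_Qn)
    hence "z1 = z2" using False by simp
    thus False using inv by (simp add: s1_def s2_def)
  next
    case True
    \<comment> \<open>Here \<open>n \<ge> 1\<close> is essential: with c^n = 0 the equation no
      longer involves the third coordinate.\<close>
    have line: "(c, w, t) \<in> points (surface_S_Qn Q n)" for t
      using m(1) n by (simp add: points_surface_S_Qn True power_0_left)
    \<comment> \<open>Along this line x' = 0, so x takes its values among the roots of p.\<close>
    have "poly p (eval3 (fst \<Psi>) (c, w, t)) = 0" for t
      using x'[OF \<Psi>[OF line[of t]]] unfolding \<Phi>\<Psi>[OF line] by (simp add: eval_triple_def True)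
    from eval3_line_constant[OF p0 this, of _ z1]
    have x: "eval3 (fst \<Psi>) (c, w, t) = 0" for t
      using inv(1) by (simp add: eval_triple_def s1_def)
    \<comment> \<open>For x = 0 the equation of S is y^4 - 5 y^2 + 4 = 0, which leaves finitely many
      values for y.\<close>
    have "poly [:4, 0, -5, 0, 1:] (eval3 (fst (snd \<Psi>)) (c, w, t)) = 0" for t
      using \<Psi>[OF line[of t]] by (simp add: mem_S_iff u_coord_def eval_triple_def x algebra_simps power2_eq_square)
    from eval3_line_constant[OF _ this, of z1 z2]
    show False
      using inv by (simp add: eval_triple_def s1_def s2_def)
  qed
qed

end

lemma not_isomorphic_S_SQn:
  assumes "n \<ge> 1"
  shows "\<not> isomorphic surface_S (surface_S_Qn Q n)"
proof
  assume "isomorphic surface_S (surface_S_Qn Q n)"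
  then obtain \<phi> \<psi> where \<phi>: "morphism surface_S (surface_S_Qn Q n) \<phi>"
    and \<psi>: "morphism (surface_S_Qn Q n) surface_S \<psi>"
    and inv: "\<forall>p \<in> points surface_S. \<psi> (\<phi> p) = p" "\<forall>q \<in> points (surface_S_Qn Q n). \<phi> (\<psi> q) = q"
    by (auto simp: isomorphic_def isomorphism_def)
  obtain \<Phi> where \<Phi>: "\<forall>p \<in> points surface_S. \<phi> p = eval_triple \<Phi> p"
    using morphism_surface_polynomial[OF \<phi>[unfolded surface_S_def surface_S_Qn_def]]
    unfolding surface_S_def by blast
  obtain \<Psi> where \<Psi>: "\<forall>q \<in> points (surface_S_Qn Q n). \<psi> q = eval_triple \<Psi> q"
    using morphism_surface_polynomial[OF \<psi>[unfolded surface_S_def surface_S_Qn_def]]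
    unfolding surface_S_Qn_def by blast
  have m: "\<And>p. p \<in> points surface_S \<Longrightarrow> \<phi> p \<in> points (surface_S_Qn Q n)"
    "\<And>q. q \<in> points (surface_S_Qn Q n) \<Longrightarrow> \<psi> q \<in> points surface_S"
    using \<phi> \<psi> by (auto simp: morphism_def)
  interpret isomorphism_S_SQn Q n \<Phi> \<Psi>
    using assms \<Phi> \<Psi> inv m by unfold_locales (metis | simp)+
  show False by (rule contradiction)
qed


section \<open>The action\<close>

lemma derivation_derivation_D: "derivation derivation_D"
  unfolding derivation_D_def[abs_def] by (rule derivation_yz)

lemma numeral_const3: "(numeral m :: poly3) = const3 (numeral m)"
  by (rule is_ring_hom_numeral[OF is_ring_hom_const3, symmetric])

text \<open>The factor 2 x z - 2 y^2 + 5 of the derivation, which is the derivative of (u + 1) (u +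
  4) in u.\<close>

definition W :: poly3 where "W = 2 * U + 5"

lemma eval3_W [simp]: "eval3 W p = 2 * u_coord p + 5"
  by (simp add: W_def)

lemma derivation_D_simps:
  "derivation_D (f + g) = derivation_D f + derivation_D g"
  "derivation_D (f - g) = derivation_D f - derivation_D g"
  "derivation_D (f * g) = f * derivation_D g + g * derivation_D f"
  "derivation_D (f ^ 2) = 2 * f * derivation_D f"
  "derivation_D (numeral m) = 0"
  "derivation_D 0 = 0"
  "derivation_D X = 0" "derivation_D Y = X * W" "derivation_D Z = X + 2 * Y * W"
proof -
  note d = derivationD[OF derivation_derivation_D]
  show "derivation_D (f + g) = derivation_D f + derivation_D g"
    "derivation_D (f * g) = f * derivation_D g + g * derivation_D f" "derivation_D 0 = 0"
    "derivation_D (numeral m) = 0"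
    by (simp_all add: d numeral_const3)
  show "derivation_D (f - g) = derivation_D f - derivation_D g"
    using d(1)[of "f - g" g] by (simp add: algebra_simps)
  show "derivation_D (f ^ 2) = 2 * f * derivation_D f"
    by (simp add: power2_eq_square d)
  show "derivation_D X = 0" "derivation_D Y = X * W" "derivation_D Z = X + 2 * Y * W"
    by (simp_all add: derivation_D_def W_def U_def algebra_simps)
qed

lemma derivation_D_W: "derivation_D W = 2 * X ^ 2"
proof -
  have "derivation_D U = X ^ 2"
    by (simp add: U_def derivation_D_simps power2_eq_square algebra_simps)
  thus ?thesis by (simp add: W_def derivation_D_simps)
qed

lemma iterates_derivation_D:
  "derivation_D (X * W) = 2 * X ^ 3"
  "derivation_D (2 * X ^ 3) = 0"
  "derivation_D (X + 2 * Y * W) = 4 * (X ^ 2 * Y) + 2 * (X * W ^ 2)"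
  "derivation_D (4 * (X ^ 2 * Y) + 2 * (X * W ^ 2)) = 12 * (X ^ 3 * W)"
  "derivation_D (12 * (X ^ 3 * W)) = 24 * X ^ 5"
  "derivation_D (24 * X ^ 5) = 0"
proof -
  have X: "derivation_D (X ^ k) = 0" for k
    by (induction k) (use derivationD(3)[OF derivation_derivation_D, of 1] in
        \<open>simp_all add: derivation_D_simps const3_simps\<close>)
  note d = derivation_D_simps X derivation_D_W
  show "derivation_D (X * W) = 2 * X ^ 3"
    unfolding d by algebra
  show "derivation_D (2 * X ^ 3) = 0" "derivation_D (24 * X ^ 5) = 0"
    unfolding d by simp_all
  show "derivation_D (X + 2 * Y * W) = 4 * (X ^ 2 * Y) + 2 * (X * W ^ 2)"
    "derivation_D (4 * (X ^ 2 * Y) + 2 * (X * W ^ 2)) = 12 * (X ^ 3 * W)"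
    "derivation_D (12 * (X ^ 3 * W)) = 24 * X ^ 5"
    unfolding d by algebra+
qed

lemma funpow_small:
  "(f ^^ 1) a = f a" "(f ^^ 2) a = f (f a)" "(f ^^ 3) a = f (f (f a))"
  "(f ^^ 4) a = f (f (f (f a)))" "(f ^^ 5) a = f (f (f (f (f a))))"
  by (simp_all add: numeral_eq_Suc)

lemma derivation_D_nilpotent_variables:
  "(derivation_D ^^ 1) X = 0" "(derivation_D ^^ 3) Y = 0" "(derivation_D ^^ 5) Z = 0"
  unfolding funpow_small derivation_D_simps(7-9) iterates_derivation_D by (rule refl)+

lemma locally_nilpotent_derivation_D: "locally_nilpotent_derivation derivation_D"
  using derivation_derivation_D derivation_D_nilpotent_variables by (rule locally_nilpotentI)

section \<open>The action in closed form\<close>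

lemma exp_derivation_eq_sum:
  assumes "derivation E" "(E ^^ N) f = 0"
  shows "exp_derivation E t f = (\<Sum>k<N. const3 (t ^ k / fact k) * (E ^^ k) f)"
  unfolding exp_derivation_def
proof (rule sum.mono_neutral_left)
  show "{k. (E ^^ k) f \<noteq> 0} \<subseteq> {..<N}"
    using derivation_nilpotent_mono[OF assms] by (auto simp: not_less[symmetric])
qed auto

lemma C_plus_action_derivation_D:
  "C_plus_action derivation_D t (x, y, z) = (let w = 2 * (x * z - y ^ 2) + 5 in
     (x, y + t * (x * w) + t ^ 2 * x ^ 3,
      z + t * (x + 2 * y * w) + t ^ 2 * (2 * (x ^ 2 * y) + x * w ^ 2) + t ^ 3 * (2 * (x ^ 3 * w))
        + t ^ 4 * x ^ 5))"
proof -
  note d = derivation_derivation_D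
  note N = derivation_D_nilpotent_variables
  have k: "{..<1} = {0::nat}" "{..<3} = {0, 1, 2::nat}" "{..<5} = {0, 1, 2, 3, 4::nat}"
    by auto
  have f: "fact 3 = (6::complex)" "fact 4 = (24::complex)"
    by (simp_all add: fact_numeral)
  show ?thesis
    unfolding C_plus_action_def exp_derivation_eq_sum[OF d N(1)] exp_derivation_eq_sum[OF d N(2)]
      exp_derivation_eq_sum[OF d N(3)] k Let_def
    by (simp add: funpow_small derivation_D_simps(7-9) iterates_derivation_D u_coord_def f)
qed

lemma fst_C_plus_action: "fst (C_plus_action derivation_D t p) = fst p"
  by (cases p) (simp add: C_plus_action_derivation_D Let_def)

text \<open>In the coordinates (x, u) the flow is a translation, because u has the derivative
  x^2.\<close>

lemma u_coord_C_plus_action: "u_coord (C_plus_action derivation_D t p) = u_coord p + t * fst p ^ 2"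
  by (cases p) (simp add: C_plus_action_derivation_D Let_def u_coord_def algebra_simps
      power2_eq_square power3_eq_cube numeral_eq_Suc)

lemma additive_group_action_D: "additive_group_action (C_plus_action derivation_D)"
  unfolding additive_group_action_def
proof (intro conjI allI)
  show "C_plus_action derivation_D 0 p = p" for p
    by (cases p) (simp add: C_plus_action_derivation_D Let_def)
  show "C_plus_action derivation_D (s + t) p = C_plus_action derivation_D s (C_plus_action derivation_D t p)"
    for s t p
  proof -
    obtain x y z where p: "p = (x, y, z)" by (cases p)
    define w where "w = 2 * (x * z - y ^ 2) + 5"
    obtain y' z' where q: "C_plus_action derivation_D t p = (x, y', z')"
      and y': "y' = y + t * (x * w) + t ^ 2 * x ^ 3"
      and z': "z' = z + t * (x + 2 * y * w) + t ^ 2 * (2 * (x ^ 2 * y) + x * w ^ 2)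
         + t ^ 3 * (2 * (x ^ 3 * w)) + t ^ 4 * x ^ 5"
      by (simp add: p C_plus_action_derivation_D Let_def w_def)
    have "x * z' - y' ^ 2 = x * z - y ^ 2 + t * x ^ 2"
      using u_coord_C_plus_action[of t p] unfolding q by (simp add: u_coord_def p)
    hence w': "2 * (x * z' - y' ^ 2) + 5 = w + 2 * t * x ^ 2"
      unfolding w_def by simp
    show ?thesis
      unfolding q unfolding p C_plus_action_derivation_D Let_def w' w_def[symmetric]
      by (simp add: y' z' power2_eq_square power3_eq_cube numeral_eq_Suc algebra_simps)
  qed
qed

text \<open>Both sides of \<open>mem_S_iff\<close> grow by t x^2 (2 u + 5) + t^2 x^4.\<close>

lemma C_plus_action_in_S:
  "C_plus_action derivation_D t p \<in> points surface_S \<longleftrightarrow> p \<in> points surface_S"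
proof -
  obtain x y z where p: "p = (x, y, z)" by (cases p)
  have "fst (snd (C_plus_action derivation_D t p)) = y + t * (x * (2 * u_coord p + 5)) + t ^ 2 * x ^ 3"
    by (simp add: p C_plus_action_derivation_D Let_def u_coord_def)
  thus ?thesis
    unfolding mem_S_iff u_coord_C_plus_action fst_C_plus_action
    by (simp add: p algebra_simps power2_eq_square power3_eq_cube)
qed

lemma C_plus_action_image_S: "C_plus_action derivation_D t ` points surface_S = points surface_S"
proof -
  have "p \<in> C_plus_action derivation_D t ` points surface_S" if "p \<in> points surface_S" for p
  proof (rule image_eqI)
    show "p = C_plus_action derivation_D t (C_plus_action derivation_D (-t) p)"
      using additive_group_action_D unfolding additive_group_action_def by (metis add.right_inverse)
    show "C_plus_action derivation_D (-t) p \<in> points surface_S"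
      using that C_plus_action_in_S by blast
  qed
  thus ?thesis using C_plus_action_in_S by blast
qed


section \<open>The quotient\<close>

lemma regular_surface_S: "regular surface_S = {restrict (eval3 f) (points surface_S) | f. True}"
  by (simp add: surface_S_def surface_def Let_def)

definition x_function :: "complex poly \<Rightarrow> point3 \<Rightarrow> complex" where
  "x_function a = (\<lambda>p \<in> points surface_S. poly a (fst p))"

text \<open>For nonzero x the orbit fills the whole fibre, so G does not involve u. Hence
  \<open>rho g\<close> has degree 0, and the normal form gives a polynomial in x without
  denominators.\<close>

lemma invariant_imp_x_function:
  assumes "\<And>t p. p \<in> points surface_S \<Longrightarrow> eval3 g (C_plus_action derivation_D t p) = eval3 g p"
  shows "\<exists>a. restrict (eval3 g) (points surface_S) = x_function a"
proof -
  obtain N G where G: "lx ^ N * rho g = map_poly fls_of_poly G"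
    "\<forall>x u. x \<noteq> 0 \<longrightarrow> eval2 G (x, u) = x ^ N * eval3 g (chart x u)"
    using rho_clear_denominator by blast
  have const: "eval2 G (x, u) = eval2 G (x, 0)" if x: "x \<noteq> 0" for x u
  proof -
    \<comment> \<open>The time u / x^2 moves the u-coordinate from 0 to u.\<close>
    define p where "p = C_plus_action derivation_D (u / x ^ 2) (chart x 0)"
    have "p \<in> points surface_S" "fst p = x" "u_coord p = u"
      using x by (simp_all add: p_def C_plus_action_in_S chart_in_S fst_C_plus_action fst_chart
          u_coord_C_plus_action u_coord_chart)
    hence "chart x u = p" using chart_u_coord x by metis
    hence "eval3 g (chart x u) = eval3 g (chart x 0)"
      using assms[OF chart_in_S[OF x]] by (simp add: p_def)
    thus ?thesis using G(2) x by simp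
  qed
  have "G - [:coeff G 0:] = 0"
  proof (rule eval2_eq_0)
    fix x u :: complex assume x: "x \<noteq> 0"
    have "eval2 G (x, 0) = poly (coeff G 0) x"
      by (simp add: eval2_def poly_0_coeff_0)
    thus "eval2 (G - [:coeff G 0:]) (x, u) = 0"
      using const[OF x, of u] by simp
  qed
  hence "G = [:coeff G 0:]" by simp
  hence "map_poly fls_of_poly G = [:fls_of_poly (coeff G 0):]"
    by (metis map_poly_pCons map_poly_0 fls_of_poly_simps(1) pCons_0_0)
  hence "degree (lx ^ N * rho g) = 0"
    using G(1) by simp
  hence "degree (rho g) = 0"
    by (cases "rho g = 0") (simp_all add: degree_mult_eq)
  then obtain a where "\<And>p. p \<in> points surface_S \<Longrightarrow> eval3 g p = poly a (fst p)"
    using rho_degree_le_1[of g] by (metis add.right_neutral le_numeral_extra(3) mult_zero_left poly_0 zero_le)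
  thus ?thesis by (intro exI[of _ a]) (auto simp: x_function_def restrict_def fun_eq_iff)
qed

lemma invariants_eq: "invariants surface_S (C_plus_action derivation_D) = range x_function"
proof (intro equalityI subsetI)
  fix f assume "f \<in> invariants surface_S (C_plus_action derivation_D)"
  then obtain g where f: "f = restrict (eval3 g) (points surface_S)"
    and "\<And>t p. p \<in> points surface_S \<Longrightarrow> f (C_plus_action derivation_D t p) = f p"
    by (auto simp: invariants_def regular_surface_S)
  hence "\<exists>a. restrict (eval3 g) (points surface_S) = x_function a"
    using C_plus_action_in_S by (intro invariant_imp_x_function) (metis restrict_apply')
  thus "f \<in> range x_function" using f by auto
next
  fix f assume "f \<in> range x_function"
  then obtain a where a: "f = x_function a" by blast
  have "x_function a = restrict (eval3 [:[:a:]:]) (points surface_S)"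
    by (simp add: x_function_def fun_eq_iff restrict_def)
  thus "f \<in> invariants surface_S (C_plus_action derivation_D)"
    unfolding a invariants_def regular_surface_S
    by (auto simp: x_function_def C_plus_action_in_S fst_C_plus_action)
qed

lemma x_function_surj: "\<exists>p \<in> points surface_S. fst p = c"
proof (cases "c = 0")
  case True
  have "(0, 1, 0) \<in> points surface_S" by (simp add: mem_S_iff u_coord_def)
  thus ?thesis using True by force
next
  case False
  thus ?thesis using chart_in_S fst_chart by blast
qed

section \<open>The spectrum of the ring of invariants\<close>

lemma algebra_hom_x_function:
  assumes \<chi>: "\<chi> \<in> algebra_homs (points surface_S) (range x_function)"
  shows "\<chi> (x_function a) = poly a (\<chi> (x_function [:0, 1:]))"
proof (induction a)
  case 0
  have 0: "x_function 0 = (\<lambda>p\<in>points surface_S. 0)" by (simp add: x_function_def)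
  have "\<chi> (\<lambda>p\<in>points surface_S. 0) = 0" using \<chi> unfolding algebra_homs_def by blast
  thus ?case unfolding 0 poly_0 .
next
  case (pCons c a)
  let ?S = "points surface_S" and ?x = "x_function [:0, 1:]"
  let ?xa = "\<lambda>p\<in>?S. ?x p * x_function a p"
  have const: "\<chi> (\<lambda>p\<in>?S. c) = c"
    using \<chi> unfolding algebra_homs_def by blast
  have add: "\<chi> (\<lambda>p\<in>?S. f p + g p) = \<chi> f + \<chi> g" if "f \<in> range x_function" "g \<in> range x_function" for f g
    using \<chi> that unfolding algebra_homs_def by blast
  have mult: "\<chi> (\<lambda>p\<in>?S. f p * g p) = \<chi> f * \<chi> g" if "f \<in> range x_function" "g \<in> range x_function" for f g
    using \<chi> that unfolding algebra_homs_def by blast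
  have xa: "?xa = x_function ([:0, 1:] * a)" and c: "(\<lambda>p\<in>?S. c) = x_function [:c:]"
    by (simp_all add: x_function_def restrict_def fun_eq_iff)
  have "x_function (pCons c a) = (\<lambda>p\<in>?S. (\<lambda>p\<in>?S. c) p + ?xa p)"
    by (simp add: x_function_def restrict_def fun_eq_iff)
  hence "\<chi> (x_function (pCons c a)) = \<chi> (\<lambda>p\<in>?S. (\<lambda>p\<in>?S. c) p + ?xa p)"
    by (rule arg_cong)
  also have "\<dots> = \<chi> (\<lambda>p\<in>?S. c) + \<chi> ?xa"
    by (rule add) (simp_all add: xa c)
  also have "\<dots> = c + \<chi> ?x * \<chi> (x_function a)"
    using const mult[of ?x "x_function a"] by simp
  finally show ?case by (simp add: pCons)
qed

lemma evaluation_algebra_hom: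
  assumes p: "p \<in> points surface_S"
  shows "(\<lambda>b \<in> range x_function. b p) \<in> algebra_homs (points surface_S) (range x_function)"
proof -
  let ?S = "points surface_S"
  have c: "(\<lambda>p\<in>?S. c) = x_function [:c:]" for c
    by (simp add: x_function_def)
  have add: "(\<lambda>p\<in>?S. x_function a p + x_function b p) = x_function (a + b)"
    and mult: "(\<lambda>p\<in>?S. x_function a p * x_function b p) = x_function (a * b)" for a b
    by (simp_all add: x_function_def restrict_def fun_eq_iff)
  show ?thesis
    using p by (auto simp: algebra_homs_def c add mult) (simp_all add: x_function_def)
qed

lemma coincides_with_quotient_S:
  "coincides_with_quotient surface_S (C_plus_action derivation_D) affine_line fst"
proof -
  let ?S = "points surface_S" and ?R = "range x_function" and ?x = "x_function [:0, 1:]"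
  let ?V = "spectrum ?S ?R" and ?\<theta> = "\<lambda>\<chi>. \<chi> (x_function [:0, 1:])"
  have pts: "points ?V = algebra_homs ?S ?R"
    and reg: "regular ?V = {\<lambda>\<chi> \<in> algebra_homs ?S ?R. \<chi> b | b. b \<in> ?R}"
    by (simp_all add: spectrum_def)
  \<comment> \<open>A set-theoretic section of x: evaluation at \<open>s c\<close> is the point of
    the spectrum that corresponds to c.\<close>
  obtain s where s: "\<And>c. s c \<in> ?S" "\<And>c. fst (s c) = c"
    using x_function_surj by metis
  define \<psi> where "\<psi> c = (\<lambda>b \<in> ?R. b (s c))" for c
  have \<psi>_hom: "\<psi> c \<in> algebra_homs ?S ?R" for c
    unfolding \<psi>_def by (rule evaluation_algebra_hom[OF s(1)])
  have \<psi>_x: "\<psi> c (x_function a) = poly a c" for c a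
    using s by (simp add: \<psi>_def x_function_def)
  have "isomorphism ?V affine_line ?\<theta>"
    unfolding isomorphism_def
  proof (intro conjI exI[of _ \<psi>] ballI)
    show "morphism ?V affine_line ?\<theta>"
      unfolding morphism_def pts
    proof (intro conjI ballI)
      fix g assume "g \<in> regular affine_line"
      then obtain a where g: "g = poly a" by (auto simp: affine_line_def)
      have "restrict (g \<circ> ?\<theta>) (algebra_homs ?S ?R) = (\<lambda>\<chi> \<in> algebra_homs ?S ?R. \<chi> (x_function a))"
        by (rule restrict_ext) (simp add: g algebra_hom_x_function[of _ a])
      thus "restrict (g \<circ> ?\<theta>) (algebra_homs ?S ?R) \<in> regular ?V"
        unfolding reg by blast
    qed (simp add: affine_line_def)
    show "morphism affine_line ?V \<psi>"
      unfolding morphism_def pts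
    proof (intro conjI ballI)
      fix g assume "g \<in> regular ?V"
      then obtain a where g: "g = (\<lambda>\<chi> \<in> algebra_homs ?S ?R. \<chi> (x_function a))"
        unfolding reg by blast
      have "restrict (g \<circ> \<psi>) (points affine_line) = poly a"
        by (simp add: affine_line_def g \<psi>_hom \<psi>_x fun_eq_iff)
      thus "restrict (g \<circ> \<psi>) (points affine_line) \<in> regular affine_line"
        by (simp add: affine_line_def)
    qed (use \<psi>_hom in auto)
    show "\<psi> (?\<theta> \<chi>) = \<chi>" if "\<chi> \<in> points ?V" for \<chi>
    proof (rule extensionalityI)
      show "\<psi> (?\<theta> \<chi>) \<in> extensional ?R" by (simp add: \<psi>_def)
      show "\<chi> \<in> extensional ?R" using that unfolding pts by (simp add: algebra_homs_def)
      fix b assume "b \<in> ?R"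
      then obtain a where "b = x_function a" by blast
      thus "\<psi> (?\<theta> \<chi>) b = \<chi> b"
        using algebra_hom_x_function[of \<chi> a] that unfolding pts by (simp add: \<psi>_x)
    qed
    show "?\<theta> (\<psi> c) = c" for c
      by (simp add: \<psi>_x)
  qed
  moreover have "?\<theta> (quotient_map surface_S (C_plus_action derivation_D) p) = fst p" if "p \<in> ?S" for p
  proof -
    have "quotient_map surface_S (C_plus_action derivation_D) p ?x = ?x p"
      unfolding quotient_map_def invariants_eq by simp
    thus ?thesis using that by (simp add: x_function_def)
  qed
  ultimately show ?thesis
    unfolding coincides_with_quotient_def algebraic_quotient_def invariants_eq by blast
qed


section \<open>The bundle over \<open>\<complex>\<^sup>*\<close>\<close>

lemma trivial_A1_bundle_S: "trivial_A1_bundle_over_Cstar surface_S fst"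
proof -
  let ?S = "points surface_S"
  define S0 where "S0 = {p \<in> ?S. fst p \<noteq> 0}"
  define P0 where "P0 = {q :: complex \<times> complex. fst q \<noteq> 0}"
  let ?V = "principal_open surface_S fst" and ?W = "principal_open affine_plane fst"
  have V: "points ?V = S0"
      "regular ?V = {restrict (\<lambda>p. f p / fst p ^ k) S0 | f k. f \<in> regular surface_S}"
    and W: "points ?W = P0"
      "regular ?W = {restrict (\<lambda>p. f p / fst p ^ k) P0 | f k. f \<in> range eval2}"
    by (simp_all add: principal_open_def Let_def S0_def P0_def affine_plane_def)
  define \<phi> where "\<phi> p = (fst p, u_coord p)" for p :: point3
  define \<psi> where "\<psi> q = chart (fst q) (snd q)" for q
  have "isomorphism ?V ?W \<phi>"
    unfolding isomorphism_def
  proof (intro conjI exI[of _ \<psi>] ballI)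
    show "morphism ?V ?W \<phi>"
      unfolding morphism_def
    proof (intro conjI ballI)
      show "\<phi> \<in> points ?V \<rightarrow> points ?W"
        unfolding V W by (auto simp: S0_def P0_def \<phi>_def)
      fix g assume "g \<in> regular ?W"
      then obtain G k where g: "g = restrict (\<lambda>p. eval2 G p / fst p ^ k) P0"
        unfolding W by blast
      \<comment> \<open>Inserting the polynomial \<open>U\<close> for u turns G into a polynomial on
        C^3.\<close>
      have "\<exists>f. \<forall>p. eval3 f p = eval2 G (fst p, u_coord p)"
      proof (induction G)
        case 0
        show ?case by (rule exI[of _ 0]) (simp add: is_ring_homD(1)[OF is_ring_hom_eval3])
      next
        case (pCons a G)
        then obtain f where "\<forall>p. eval3 f p = eval2 G (fst p, u_coord p)" by blast
        thus ?case by (intro exI[of _ "[:[:a:]:] + U * f"]) (simp del: add_pCons)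
      qed
      then obtain f where f: "\<And>p. eval3 f p = eval2 G (fst p, u_coord p)" by blast
      have "restrict (g \<circ> \<phi>) S0 = restrict (\<lambda>p. restrict (eval3 f) ?S p / fst p ^ k) S0"
        by (rule restrict_ext) (simp add: g f \<phi>_def S0_def P0_def)
      thus "restrict (g \<circ> \<phi>) (points ?V) \<in> regular ?V"
        unfolding V regular_surface_S by blast
    qed
    show "morphism ?W ?V \<psi>"
      unfolding morphism_def
    proof (intro conjI ballI)
      show "\<psi> \<in> points ?W \<rightarrow> points ?V"
        unfolding V W by (auto simp: S0_def P0_def \<psi>_def chart_in_S fst_chart)
      fix g assume "g \<in> regular ?V"
      then obtain f k where g: "g = restrict (\<lambda>p. restrict (eval3 f) ?S p / fst p ^ k) S0"
        unfolding V regular_surface_S by blast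
      obtain N G where G: "\<forall>x u. x \<noteq> 0 \<longrightarrow> eval2 G (x, u) = x ^ N * eval3 f (chart x u)"
        using rho_clear_denominator[of f] by blast
      \<comment> \<open>The exponent N clears the denominators of f on the chart; k is the one
        already present in g.\<close>
      have "restrict (g \<circ> \<psi>) P0 = restrict (\<lambda>p. eval2 G p / fst p ^ (N + k)) P0"
        by (rule restrict_ext)
          (use G in \<open>auto simp: g \<psi>_def S0_def P0_def chart_in_S fst_chart power_add\<close>)
      thus "restrict (g \<circ> \<psi>) (points ?W) \<in> regular ?W"
        unfolding W by blast
    qed
    show "\<psi> (\<phi> p) = p" if "p \<in> points ?V" for p
      using that chart_u_coord unfolding V by (simp add: \<psi>_def \<phi>_def S0_def)
    show "\<phi> (\<psi> q) = q" if "q \<in> points ?W" for q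
      using that unfolding W by (simp add: \<psi>_def \<phi>_def P0_def u_coord_chart fst_chart)
  qed
  moreover have "morphism surface_S affine_line fst"
    unfolding morphism_def
  proof (intro conjI ballI)
    fix g assume "g \<in> regular affine_line"
    then obtain a where g: "g = poly a" by (auto simp: affine_line_def)
    have "restrict (g \<circ> fst) ?S = restrict (eval3 [:[:a:]:]) ?S"
      by (rule restrict_ext) (simp add: g)
    thus "restrict (g \<circ> fst) ?S \<in> regular surface_S"
      unfolding regular_surface_S by blast
  qed (simp add: affine_line_def)
  ultimately show ?thesis
    unfolding trivial_A1_bundle_over_Cstar_def by (auto simp: \<phi>_def)
qed


theorem mainTheorem1:
  "(\<forall>(Q :: poly2) (n :: nat). n \<ge> 1 \<longrightarrow> \<not> isomorphic surface_S (surface_S_Qn Q n)) \<and>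
   locally_nilpotent_derivation derivation_D \<and>
   additive_group_action (C_plus_action derivation_D) \<and>
   (\<forall>t. C_plus_action derivation_D t ` points surface_S = points surface_S) \<and>
   coincides_with_quotient surface_S (C_plus_action derivation_D) affine_line fst \<and>
   trivial_A1_bundle_over_Cstar surface_S fst"
  using not_isomorphic_S_SQn locally_nilpotent_derivation_D additive_group_action_D
    C_plus_action_image_S coincides_with_quotient_S trivial_A1_bundle_S
  by blast

end
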